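(* Let $\prec$ be a monomial ordering, let $F$ be a Gröbner basis (with respect to $\prec$) of an ideal $I$ of $\mathbb{Q}[X]$ and let $p$ be a prime number permissible for $(F,\prec)$. Let $U\subset X$ be such that $\mathrm{Ass}_U(I_p(F))$ is not empty, and let $\bar H$ be a Gröbner basis (with respect to $\prec$) of $$\bar J=\bigcap_{P_p\in \mathrm{Ass}_U(I_p(F))}P_p\subset \mathbb{F}_p[X].$$ Let $H_{can}\subset\mathbb{Q}[X]$ be a Gröbner basis candidate constructed from $\bar H$, i.e. a finite set, lifted from $\bar H$, for which $\phi_p(H_{can})=\bar H$; put $J=I(H_{can})$. Assume that $p$ is permissible for $(H_{can},\prec)$. Suppose that $H_{can}$ is a Gröbner basis of $J$ with respect to $\prec$, and that $p$ is effectively lucky for the reduced Gröbner basis $L$ of $(I:J)$ with respect to $\prec$, with $I_p(L)=(I_p(F):I_p(H_{can}))$. If $J$ is a prime ideal, then $J$ is a prime divisor of $I$.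
   Context: $X=\{x_1,\ldots,x_n\}$ is a finite set of variables. For a prime number $p$, $\mathbb{Z}_{(p)}=\{a/b\in\mathbb{Q}\mid p\nmid b\}$ and $\phi_p:\mathbb{Z}_{(p)}[X]\to\mathbb{F}_p[X]$ is the canonical projection (reduction of coefficients modulo $p$). For $F\subset\mathbb{Q}[X]$, $I(F)$ is the ideal of $\mathbb{Q}[X]$ generated by $F$. For $F\subset \mathbb{Z}_{(p)}[X]$, $I_p(F)$ is the ideal of $\mathbb{F}_p[X]$ generated by $\phi_p(F)$. For ideals $A,B$ of a ring, $(A:B)=\{f\mid fB\subset A\}$. A prime $p$ is *permissible* for $(F,\prec)$ if $F\subset\mathbb{Z}_{(p)}[X]$ and $\phi_p(\mathrm{lc}_\prec(f))\neq 0$ for all $f\in F$, where $\mathrm{lc}_\prec(f)$ is the leading coefficient of $f$ with respect to $\prec$. A prime $p$ is *effectively lucky* for $F$ and $\prec$ if, with $G$ the reduced Gröbner basis of $I(F)$ with respect to $\prec$, $p$ is permissible for $(G,\prec)$ and $\phi_p(G)$ is the reduced Gröbner basis of $I_p(G)$. $\mathrm{Ass}(I)$ is the set of prime divisors (associated primes) of an ideal $I$. A subset $U\subset X$ is a *maximal independent set* (MIS) of a prime ideal $P\subset K[X]$ ($K$ a field) if $K[U]\cap P=\{0\}$ and $U$ is maximal with this property (equivalently $\#U=\dim K[X]/P$). For a subset $U\subset X$, $\mathrm{Ass}_U(I_p(F))=\{\bar P_p\in\mathrm{Ass}(I_p(F))\mid U \text{ is a MIS of } \bar P_p\}$. *)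

theory Defs
  imports
    "HOL-Library.Poly_Mapping"
    "HOL-Algebra.Ideal"
    "HOL-Decision_Procs.Algebra_Aux"
    "Berlekamp_Zassenhaus.Finite_Field"
begin

section \<open>Polynomial rings and their ideals\<close>

text \<open>
  Monomials are exponent vectors, so that products of monomials are sums and the monomial 1 is 0.
  The finite type of variables plays the role of X, and \<open>'p mod_ring\<close> with \<open>'p :: prime_card\<close> that
  of the prime field with \<open>p = CARD('p)\<close> elements.
\<close>

type_synonym 'x monom = "'x \<Rightarrow>\<^sub>0 nat"
type_synonym ('x, 'a) mpoly = "'x monom \<Rightarrow>\<^sub>0 'a"

abbreviation mpoly_ring :: "('x, 'a::comm_ring_1) mpoly ring"
  where "mpoly_ring \<equiv> cring_class_ops"

abbreviation ideal_gen :: "('x, 'a::comm_ring_1) mpoly set \<Rightarrow> ('x, 'a) mpoly set"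
  where "ideal_gen B \<equiv> genideal mpoly_ring B"

definition colon ::
    "('x, 'a::comm_ring_1) mpoly set \<Rightarrow> ('x, 'a) mpoly set \<Rightarrow> ('x, 'a) mpoly set"
  where "colon A B = {f. \<forall>b\<in>B. f * b \<in> A}"

text \<open>Associated primes, as the prime ideals of the form \<open>(I : f)\<close>.\<close>

definition Ass :: "('x, 'a::comm_ring_1) mpoly set \<Rightarrow> ('x, 'a) mpoly set set"
  where "Ass I = {P. primeideal P mpoly_ring \<and> (\<exists>f. P = colon I {f})}"

definition polys_in :: "'x set \<Rightarrow> ('x, 'a::zero) mpoly set"
  where "polys_in U = {f. \<forall>t\<in>Poly_Mapping.keys f. Poly_Mapping.keys t \<subseteq> U}"

definition independent_mod :: "'x set \<Rightarrow> ('x, 'a::comm_ring_1) mpoly set \<Rightarrow> bool"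
  where "independent_mod U P \<longleftrightarrow> polys_in U \<inter> P = {0}"

definition is_MIS :: "'x set \<Rightarrow> ('x, 'a::comm_ring_1) mpoly set \<Rightarrow> bool"
  where "is_MIS U P \<longleftrightarrow>
    independent_mod U P \<and> (\<forall>V. U \<subset> V \<longrightarrow> \<not> independent_mod V P)"

definition Ass_MIS :: "'x set \<Rightarrow> ('x, 'a::comm_ring_1) mpoly set \<Rightarrow> ('x, 'a) mpoly set set"
  where "Ass_MIS U I = {P \<in> Ass I. is_MIS U P}"


section \<open>Monomial orderings and Groebner bases\<close>

text \<open>A monomial ordering is given by its reflexive version.\<close>

definition monomial_order :: "('x monom \<Rightarrow> 'x monom \<Rightarrow> bool) \<Rightarrow> bool"
  where "monomial_order mo \<longleftrightarrow>
    class.linorder mo (\<lambda>s t. mo s t \<and> \<not> mo t s) \<and>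
    (\<forall>s. mo 0 s) \<and> (\<forall>s t u. mo s t \<longrightarrow> mo (s + u) (t + u))"

definition lead_monom :: "('x monom \<Rightarrow> 'x monom \<Rightarrow> bool) \<Rightarrow> ('x, 'a::zero) mpoly \<Rightarrow> 'x monom"
  where "lead_monom mo f = (THE t. t \<in> Poly_Mapping.keys f \<and> (\<forall>s\<in>Poly_Mapping.keys f. mo s t))"

text \<open>
  The leading monomial of the zero polynomial is unspecified, but its leading coefficient and its
  leading term are 0.
\<close>

definition lc :: "('x monom \<Rightarrow> 'x monom \<Rightarrow> bool) \<Rightarrow> ('x, 'a::zero) mpoly \<Rightarrow> 'a"
  where "lc mo f = Poly_Mapping.lookup f (lead_monom mo f)"

definition lead_term :: "('x monom \<Rightarrow> 'x monom \<Rightarrow> bool) \<Rightarrow> ('x, 'a::zero) mpoly \<Rightarrow> ('x, 'a) mpoly"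
  where "lead_term mo f = Poly_Mapping.single (lead_monom mo f) (lc mo f)"

definition groebner_basis ::
    "('x monom \<Rightarrow> 'x monom \<Rightarrow> bool) \<Rightarrow> ('x, 'a::field) mpoly set \<Rightarrow> ('x, 'a) mpoly set \<Rightarrow> bool"
  where "groebner_basis mo G I \<longleftrightarrow>
    finite G \<and> G \<subseteq> I \<and> ideal_gen (lead_term mo ` G) = ideal_gen (lead_term mo ` I)"

definition reduced_groebner_basis ::
    "('x monom \<Rightarrow> 'x monom \<Rightarrow> bool) \<Rightarrow> ('x, 'a::field) mpoly set \<Rightarrow> ('x, 'a) mpoly set \<Rightarrow> bool"
  where "reduced_groebner_basis mo G I \<longleftrightarrow>
    groebner_basis mo G I \<and>
    (\<forall>g\<in>G. lc mo g = 1 \<and>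
      (\<forall>t\<in>Poly_Mapping.keys g. Poly_Mapping.single t 1 \<notin> ideal_gen (lead_term mo ` (G - {g}))))"


section \<open>Reduction modulo a prime\<close>

definition Z_loc :: "nat \<Rightarrow> rat set"
  where "Z_loc p = {of_int a / of_int b | a b. \<not> int p dvd b}"

definition Z_loc_polys :: "nat \<Rightarrow> ('x, rat) mpoly set"
  where "Z_loc_polys p = {f. \<forall>t. Poly_Mapping.lookup f t \<in> Z_loc p}"

text \<open>Only meaningful on \<open>Z_loc CARD('p)\<close>, where the reduced denominator is invertible modulo p.\<close>

definition phi_coeff :: "rat \<Rightarrow> 'p::prime_card mod_ring"
  where "phi_coeff r = of_int (fst (quotient_of r)) / of_int (snd (quotient_of r))"

definition phi :: "('x, rat) mpoly \<Rightarrow> ('x, 'p::prime_card mod_ring) mpoly"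
  where "phi = Poly_Mapping.map phi_coeff"

definition I_p :: "('x, rat) mpoly set \<Rightarrow> ('x, 'p::prime_card mod_ring) mpoly set"
  where "I_p F = ideal_gen (phi ` F)"

definition permissible ::
    "'p::prime_card itself \<Rightarrow> ('x monom \<Rightarrow> 'x monom \<Rightarrow> bool) \<Rightarrow> ('x, rat) mpoly set \<Rightarrow> bool"
  where "permissible _ mo F \<longleftrightarrow>
    F \<subseteq> Z_loc_polys CARD('p) \<and> (\<forall>f\<in>F. (phi_coeff (lc mo f) :: 'p mod_ring) \<noteq> 0)"

definition effectively_lucky ::
    "'p::prime_card itself \<Rightarrow> ('x monom \<Rightarrow> 'x monom \<Rightarrow> bool) \<Rightarrow> ('x, rat) mpoly set \<Rightarrow> bool"
  where "effectively_lucky _ mo F \<longleftrightarrow>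
    (\<exists>G. reduced_groebner_basis mo G (ideal_gen F) \<and>
      permissible TYPE('p) mo G \<and>
      reduced_groebner_basis mo (phi ` G) (I_p G :: ('x, 'p mod_ring) mpoly set))"

end

theory Submission
  imports Defs
begin

text \<open>
  Let \<open>I'\<close> be \<open>I_p F\<close>, let \<open>J'\<close> be \<open>Jbar\<close>, and let \<open>P = (I' : f)\<close> be in \<open>Ass_MIS U I'\<close>. If a nonzero \<open>h\<close> in \<open>\<rat>[U]\<close>
  satisfied \<open>h (I : J) \<subseteq> I\<close>, then, after scaling \<open>h\<close> to be primitive at \<open>p\<close>, its reduction would map
  \<open>(I' : J')\<close>, which contains \<open>f\<close>, into \<open>I'\<close>, and so would be a nonzero element of \<open>P\<close> in the variables
  \<open>U\<close>. As \<open>(I : J)\<close> is finitely generated, it contains some \<open>g\<close> with \<open>h g \<notin> I\<close> for all such \<open>h\<close>.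
  Then \<open>J = (I : g)\<close>: for \<open>a \<notin> J\<close> with \<open>a g \<in> I\<close> there is a nonzero \<open>h\<close> in \<open>\<rat>[U]\<close> with \<open>h \<in> J + (a)\<close>,
  whence \<open>h g \<in> I\<close>.

  The existence of \<open>h\<close> says that \<open>a\<close> is algebraic over \<open>\<rat>(U)\<close> modulo \<open>J\<close>. It is obtained by counting,
  since \<open>J\<close> and \<open>J'\<close> have the same standard monomials. Choose positive weights for which the leading
  monomial of each element of \<open>Hcan\<close> is its unique monomial of maximal weight, so that division by
  \<open>Hcan\<close> does not increase weights. The number of standard monomials of weight less than \<open>D\<close> is
  \<open>O(D ^ card U)\<close>, because every variable is algebraic over \<open>U\<close> modulo \<open>J'\<close>; this leaves no room for the
  monomials in \<open>U\<close> together with the powers of \<open>a\<close> to be independent modulo \<open>J\<close>.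
\<close>

section \<open>Ideals as submodules\<close>

text \<open>A commutative ring is a module over itself whose submodules are exactly its ideals.
  Spans, closure rules and finite-sum descriptions of generated ideals thus come from the theory of
  modules.\<close>

interpretation ideals: Modules.module "(*) :: 'a::comm_ring_1 \<Rightarrow> 'a \<Rightarrow> 'a"
  by standard (auto simp: algebra_simps)

text \<open>For ring multiplication this rule reassociates products to the left, against
  \<open>mult.assoc\<close>.\<close>

declare ideals.scale_scale [simp del]

lemma ideal_iff_subspace: "ideal I cring_class_ops \<longleftrightarrow> ideals.subspace I"
proof
  assume "ideal I cring_class_ops"
  then interpret I: ideal I cring_class_ops .
  show "ideals.subspace I"
    using I.a_closed I.zero_closed I.I_l_closed
    by (auto simp: ideals.subspace_def cring_class_ops_def)
next
  assume I: "ideals.subspace I"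
  show "ideal I cring_class_ops"
  proof (rule idealI)
    show "ring cring_class_ops"
      by (rule cring_class.ring_axioms)
    show "subgroup I (add_monoid cring_class_ops)"
    proof (rule group.subgroupI)
      show "Group.group (add_monoid cring_class_ops)"
        by (rule abelian_group.a_group[OF ring.is_abelian_group[OF cring.axioms(1)[OF cring_class]]])
      show "I \<noteq> {}"
        using ideals.subspace_0[OF I] by blast
      fix a assume "a \<in> I"
      moreover have "inv\<^bsub>add_monoid cring_class_ops\<^esub> a = - a"
        using uminus_class[of a] by (simp add: a_inv_def)
      ultimately show "inv\<^bsub>add_monoid cring_class_ops\<^esub> a \<in> I"
        using ideals.subspace_neg[OF I] by simp
    qed (use ideals.subspace_add[OF I] in \<open>auto simp: cring_class_ops_def\<close>)
  next
    fix a x assume "a \<in> I"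
    then show "x \<otimes>\<^bsub>cring_class_ops\<^esub> a \<in> I" "a \<otimes>\<^bsub>cring_class_ops\<^esub> x \<in> I"
      using ideals.subspace_scale[OF I, of a x] by (simp_all add: cring_class_ops_def mult.commute)
  qed
qed

lemma genideal_eq_span: "genideal cring_class_ops B = ideals.span B"
  unfolding genideal_def ideal_iff_subspace ideals.span_def hull_def by (simp add: conj_commute)

lemma primeideal_iff:
  "primeideal P (cring_class_ops :: 'a::comm_ring_1 ring) \<longleftrightarrow>
    ideals.subspace P \<and> P \<noteq> UNIV \<and> (\<forall>a b. a * b \<in> P \<longrightarrow> a \<in> P \<or> b \<in> P)"
  (is "?L = ?R")
proof
  assume L: ?L
  then interpret P: primeideal P cring_class_ops .
  show ?R
    using P.I_prime P.I_notcarr P.is_ideal[unfolded ideal_iff_subspace]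
    by (auto simp: cring_class_ops_def)
next
  assume R: ?R
  show ?L
  proof (rule primeidealI[OF _ cring_class])
    show "ideal P cring_class_ops"
      using R by (simp add: ideal_iff_subspace)
    show "carrier cring_class_ops \<noteq> P"
      using R by (auto simp: cring_class_ops_def)
  qed (use R in \<open>simp add: times_class\<close>)
qed

lemma prime_ideal_power:
  assumes "primeideal P (cring_class_ops :: 'a::comm_ring_1 ring)" "a ^ n \<in> P"
  shows "a \<in> P"
  using assms(2)
proof (induction n)
  case 0
  \<comment> \<open>With \<open>a ^ 0 = 1\<close> in \<open>P\<close> the ideal would be the whole
    ring, which a prime ideal is not.\<close>
  then have "x * 1 \<in> P" for x
    using assms(1) ideals.subspace_scale[of P 1 x] by (auto simp: primeideal_iff)
  then show ?case
    by simp
next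
  case (Suc n)
  then show ?case
    using assms(1) by (auto simp: primeideal_iff)
qed

section \<open>Coefficients of products\<close>

lemma poly_mapping_sum_single:
  fixes f :: "'k \<Rightarrow>\<^sub>0 'a::comm_monoid_add"
  assumes "finite A" "Poly_Mapping.keys f \<subseteq> A"
  shows "f = (\<Sum>t\<in>A. Poly_Mapping.single t (Poly_Mapping.lookup f t))"
proof (rule poly_mapping_eqI)
  fix k
  show "Poly_Mapping.lookup f k = Poly_Mapping.lookup (\<Sum>t\<in>A. Poly_Mapping.single t (Poly_Mapping.lookup f t)) k"
    using assms by (auto simp: lookup_sum lookup_single when_def sum.delta in_keys_iff)
qed

lemma single_times:
  fixes f :: "('x, 'a::comm_ring_1) mpoly"
  shows "Poly_Mapping.single t c * f =
    (\<Sum>s\<in>Poly_Mapping.keys f. Poly_Mapping.single (t + s) (c * Poly_Mapping.lookup f s))"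
  by (subst poly_mapping_sum_single[of "Poly_Mapping.keys f" f])
    (auto simp: sum_distrib_left mult_single)

lemma lookup_single_times:
  fixes f :: "('x, 'a::comm_ring_1) mpoly"
  shows "Poly_Mapping.lookup (Poly_Mapping.single t c * f) (t + s) = c * Poly_Mapping.lookup f s"
  by (auto simp: single_times lookup_sum lookup_single when_def sum.delta in_keys_iff)

lemma lookup_const_times:
  fixes f :: "('x, 'a::comm_ring_1) mpoly"
  shows "Poly_Mapping.lookup (Poly_Mapping.single 0 c * f) s = c * Poly_Mapping.lookup f s"
  using lookup_single_times[of 0 c f s] by simp

lemma keys_single_times:
  fixes f :: "('x, 'a::comm_ring_1) mpoly"
  shows "Poly_Mapping.keys (Poly_Mapping.single t c * f) \<subseteq> (+) t ` Poly_Mapping.keys f"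
  using keys_mult[of "Poly_Mapping.single t c" f] by (fastforce split: if_splits)

lemma keys_mult_subset:
  fixes f g :: "('x, 'a::comm_ring_1) mpoly"
  shows "t \<in> Poly_Mapping.keys (f * g) \<Longrightarrow>
    \<exists>a\<in>Poly_Mapping.keys f. \<exists>b\<in>Poly_Mapping.keys g. t = a + b"
  using keys_mult[of f g] by blast

lemma single_in_ideal:
  fixes c :: "'a::field"
  assumes "ideals.subspace I" "Poly_Mapping.single t c \<in> I" "c \<noteq> 0"
  shows "Poly_Mapping.single (t + u) d \<in> (I :: ('x, 'a) mpoly set)"
  using ideals.subspace_scale[OF assms(1,2), of "Poly_Mapping.single u (d / c)"] assms(3)
  by (simp add: mult_single add.commute)

lemma keys_monomial_ideal:
  fixes f :: "('x, 'a::comm_ring_1) mpoly"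
  assumes "f \<in> ideals.span ((\<lambda>m. Poly_Mapping.single (s m) (c m)) ` M)" "t \<in> Poly_Mapping.keys f"
  shows "\<exists>m\<in>M. c m \<noteq> 0 \<and> (\<exists>u. t = u + s m)"
  using assms
proof (induction arbitrary: t rule: ideals.span_induct_alt)
  case base
  then show ?case by simp
next
  case (step q x y)
  then consider "t \<in> Poly_Mapping.keys (q * x)" | "t \<in> Poly_Mapping.keys y"
    using keys_add[of "q * x" y] by auto
  then show ?case
  proof cases
    case 1
    obtain m where m: "m \<in> M" "x = Poly_Mapping.single (s m) (c m)"
      using step by auto
    obtain a b where "t = a + b" "b \<in> Poly_Mapping.keys x"
      using keys_mult_subset[OF 1] by blast
    then show ?thesis
      using m by (auto split: if_splits)
  qed (use step in blast)
qed

section \<open>Dickson's lemma\<close>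

text \<open>A monotone subsequence always exists; if it is decreasing, it is constant from the point
  where it attains its minimum.\<close>

lemma nat_mono_subseq:
  fixes g :: "nat \<Rightarrow> nat"
  obtains r :: "nat \<Rightarrow> nat" where "strict_mono r" "mono (g \<circ> r)"
proof -
  obtain r where r: "strict_mono r" "monoseq (\<lambda>n. g (r n))"
    using seq_monosub[of g] by auto
  show ?thesis
  proof (cases "incseq (\<lambda>n. g (r n))")
    case True
    then show ?thesis
      using r(1) that[of r] by (simp add: comp_def)
  next
    case False
    then have dec: "decseq (\<lambda>n. g (r n))"
      using r(2) monoseq_iff by auto
    obtain N where N: "\<And>n. g (r N) \<le> g (r n)"
      using ex_has_least_nat[of "\<lambda>_. True" _ "\<lambda>n. g (r n)"] by auto
    have "g (r (N + n)) = g (r N)" for n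
      using N[of "N + n"] decseqD[OF dec, of N "N + n"] by simp
    then show ?thesis
      using r(1) that[of "\<lambda>n. r (N + n)"] by (simp add: comp_def mono_def strict_mono_def)
  qed
qed

text \<open>Passing to nondecreasing subsequences for one variable after the other makes all
  exponents nondecreasing, so that the first chosen monomial divides the second.\<close>

lemma dickson_sequence:
  fixes f :: "nat \<Rightarrow> 'x::finite monom"
  shows "\<exists>i j. i < j \<and> (\<exists>u. f j = u + f i)"
proof -
  have "\<exists>r :: nat \<Rightarrow> nat. strict_mono r \<and> (\<forall>x\<in>A. mono (\<lambda>n. Poly_Mapping.lookup (f (r n)) x))" for A :: "'x set"
    using finite[of A]
  proof (induction rule: finite_induct)
    case empty
    show ?case
      by (rule exI[of _ id]) (simp add: strict_mono_def)
  next
    case (insert x A)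
    then obtain r :: "nat \<Rightarrow> nat" where r: "strict_mono r" "\<forall>x\<in>A. mono (\<lambda>n. Poly_Mapping.lookup (f (r n)) x)"
      by blast
    obtain q :: "nat \<Rightarrow> nat" where q: "strict_mono q" "mono ((\<lambda>n. Poly_Mapping.lookup (f (r n)) x) \<circ> q)"
      by (rule nat_mono_subseq)
    have "strict_mono (r \<circ> q)"
      using r(1) q(1) by (simp add: strict_mono_o)
    moreover have "mono (\<lambda>n. Poly_Mapping.lookup (f ((r \<circ> q) n)) y)" if "y \<in> insert x A" for y
      using that r(2) q strict_mono_mono[OF q(1)] by (auto simp: comp_def mono_def)
    ultimately show ?case
      by blast
  qed
  then obtain r :: "nat \<Rightarrow> nat" where r: "strict_mono r" "\<And>x. mono (\<lambda>n. Poly_Mapping.lookup (f (r n)) x)"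
    by (metis UNIV_I)
  have "f (r 1) = (f (r 1) - f (r 0)) + f (r 0)"
    using r(2) by (intro poly_mapping_eqI) (auto simp: lookup_add lookup_minus mono_def)
  then show ?thesis
    using strict_monoD[OF r(1), of 0 1] by (metis zero_less_one)
qed

text \<open>If no finite subset sufficed, one could go on picking monomials divisible by none of the
  earlier picks, contrary to \<open>dickson_sequence\<close>.\<close>

lemma dickson_finite:
  fixes T :: "'x::finite monom set"
  obtains T0 where "finite T0" "T0 \<subseteq> T" "\<And>t. t \<in> T \<Longrightarrow> \<exists>s\<in>T0. \<exists>u. t = u + s"
proof (rule ccontr)
  assume neg: "\<not> thesis"
  have "\<exists>t. t \<in> T \<and> (\<forall>s\<in>T0. \<forall>u. t \<noteq> u + s)" if "finite T0" "T0 \<subseteq> T" for T0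
    using that neg \<open>\<And>T0. \<lbrakk>finite T0; T0 \<subseteq> T; \<And>t. t \<in> T \<Longrightarrow> \<exists>s\<in>T0. \<exists>u. t = u + s\<rbrakk> \<Longrightarrow> thesis\<close>
    by metis
  then obtain pick where pick:
    "\<And>T0. finite T0 \<Longrightarrow> T0 \<subseteq> T \<Longrightarrow> pick T0 \<in> T \<and> (\<forall>s\<in>T0. \<forall>u. pick T0 \<noteq> u + s)"
    by metis
  \<comment> \<open>\<open>A n\<close> is the set of the first \<open>n\<close> picks.\<close>
  define A where "A = rec_nat {} (\<lambda>_ S. insert (pick S) S)"
  have A_Suc: "A (Suc n) = insert (pick (A n)) (A n)" for n
    by (simp add: A_def)
  have A: "finite (A n) \<and> A n \<subseteq> T" for n
    by (induction n) (use pick in \<open>auto simp: A_def\<close>)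
  have "mono A"
    by (rule mono_iff_le_Suc[THEN iffD2]) (auto simp: A_Suc)
  then have "pick (A i) \<in> A j" if "i < j" for i j
    using that A_Suc[of i] monoD[of A "Suc i" j] by auto
  then show False
    using dickson_sequence[of "\<lambda>n. pick (A n)"] pick A by blast
qed

section \<open>Leading monomials\<close>

locale monomial_ordering =
  fixes mo :: "'x::finite monom \<Rightarrow> 'x monom \<Rightarrow> bool" (infix \<open>\<preceq>\<close> 50)
  assumes monomial_order: "monomial_order (\<preceq>)"
begin

abbreviation lm :: "('x, 'a::zero) mpoly \<Rightarrow> 'x monom"
  where "lm \<equiv> lead_monom (\<preceq>)"

sublocale mo: linorder "(\<preceq>)" "\<lambda>s t. s \<preceq> t \<and> \<not> t \<preceq> s"
  using monomial_order by (simp add: monomial_order_def)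

lemma zero_preceq: "0 \<preceq> t"
  using monomial_order by (simp add: monomial_order_def)

lemma add_mono_right: "s \<preceq> t \<Longrightarrow> s + u \<preceq> t + u"
  using monomial_order by (simp add: monomial_order_def)

lemma add_mono_left: "s \<preceq> t \<Longrightarrow> u + s \<preceq> u + t"
  using add_mono_right by (simp add: add.commute)

lemma preceq_add: "t \<preceq> u + t"
  using add_mono_right[OF zero_preceq, of t u] by simp

lemma add_preceq_cancel: "u + s \<preceq> u + t \<longleftrightarrow> s \<preceq> t"
  by (metis add_left_cancel add_mono_left mo.order_antisym mo.linear)

text \<open>The reason why the product of two leading terms cannot be cancelled by other terms of
  the product.\<close>

lemma add_eq_top:
  assumes "a \<preceq> s" "b \<preceq> t" "a + b = s + t"
  shows "a = s \<and> b = t"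
proof -
  have "a + t \<preceq> a + b"
    using assms(3) add_mono_right[OF assms(1), of t] by simp
  then have "b = t"
    using assms(2) add_preceq_cancel mo.order_antisym by blast
  then show ?thesis
    using assms(3) by simp
qed

text \<open>In an infinite descending chain some term would divide a later one by Dickson's lemma,
  and a divisor is never larger than its multiple.\<close>

lemma wf_preceq: "wf {(s, t). s \<preceq> t \<and> s \<noteq> t}"
proof (rule wf_iff_no_infinite_down_chain[THEN iffD2], rule notI)
  assume "\<exists>f. \<forall>i. (f (Suc i), f i) \<in> {(s, t). s \<preceq> t \<and> s \<noteq> t}"
  then obtain f where f: "\<And>i. f (Suc i) \<preceq> f i \<and> f (Suc i) \<noteq> f i"
    by auto
  have anti: "i < j \<Longrightarrow> f j \<preceq> f i \<and> f j \<noteq> f i" for i j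
  proof (induction j rule: nat.induct)
    case (Suc j)
    then show ?case
      using f[of j] by (metis less_antisym mo.order_antisym mo.order_trans)
  qed simp
  obtain i j u where "i < j" "f j = u + f i"
    using dickson_sequence by blast
  then show False
    using anti[of i j] preceq_add[of "f i" u] mo.order_antisym by metis
qed

lemma
  assumes "f \<noteq> 0"
  shows lm_in_keys: "lm f \<in> Poly_Mapping.keys f"
    and lm_max_aux: "\<forall>s\<in>Poly_Mapping.keys f. s \<preceq> lm f"
proof -
  let ?m = "mo.Max (Poly_Mapping.keys f)"
  have m: "?m \<in> Poly_Mapping.keys f \<and> (\<forall>s\<in>Poly_Mapping.keys f. s \<preceq> ?m)"
    using assms by simp
  have "lm f = ?m"
    unfolding lead_monom_def by (rule the_equality) (use m mo.order_antisym in auto)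
  then show "lm f \<in> Poly_Mapping.keys f" "\<forall>s\<in>Poly_Mapping.keys f. s \<preceq> lm f"
    using m by auto
qed

lemma lm_max: "s \<in> Poly_Mapping.keys f \<Longrightarrow> s \<preceq> lm f"
  using lm_max_aux[of f] by (cases "f = 0") auto

lemma lm_eqI:
  assumes "t \<in> Poly_Mapping.keys f" "\<And>s. s \<in> Poly_Mapping.keys f \<Longrightarrow> s \<preceq> t"
  shows "lm f = t"
  unfolding lead_monom_def by (rule the_equality) (use assms mo.order_antisym in auto)

lemma lc_nonzero: "f \<noteq> 0 \<Longrightarrow> lc (\<preceq>) f \<noteq> 0"
  using lm_in_keys[of f] by (simp add: lc_def in_keys_iff)

lemma lookup_mult_lm:
  fixes f g :: "('x, 'a::comm_ring_1) mpoly"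
  shows "Poly_Mapping.lookup (f * g) (lm f + lm g) = lc (\<preceq>) f * lc (\<preceq>) g"
proof -
  have *: "f * g = (\<Sum>a\<in>Poly_Mapping.keys f. \<Sum>b\<in>Poly_Mapping.keys g.
    Poly_Mapping.single (a + b) (Poly_Mapping.lookup f a * Poly_Mapping.lookup g b))"
    by (subst poly_mapping_sum_single[of "Poly_Mapping.keys f" f])
      (simp_all add: sum_distrib_right single_times)
  have "Poly_Mapping.lookup (f * g) (lm f + lm g) =
    (\<Sum>a\<in>Poly_Mapping.keys f. \<Sum>b\<in>Poly_Mapping.keys g.
      if a = lm f then if b = lm g then Poly_Mapping.lookup f a * Poly_Mapping.lookup g b else 0 else 0)"
    unfolding * lookup_sum
  proof (intro sum.cong refl)
    fix a b assume "a \<in> Poly_Mapping.keys f" "b \<in> Poly_Mapping.keys g"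
    then have "a + b = lm f + lm g \<longleftrightarrow> a = lm f \<and> b = lm g"
      using add_eq_top[of a "lm f" b "lm g"] lm_max[of a f] lm_max[of b g] by auto
    then show "Poly_Mapping.lookup (Poly_Mapping.single (a + b)
        (Poly_Mapping.lookup f a * Poly_Mapping.lookup g b)) (lm f + lm g) =
      (if a = lm f then if b = lm g then Poly_Mapping.lookup f a * Poly_Mapping.lookup g b else 0 else 0)"
      by (simp add: lookup_single when_def)
  qed
  also have "\<dots> = (\<Sum>a\<in>Poly_Mapping.keys f. if a = lm f then \<Sum>b\<in>Poly_Mapping.keys g.
      if b = lm g then Poly_Mapping.lookup f a * Poly_Mapping.lookup g b else 0 else 0)"
    by (intro sum.cong refl) simp
  also have "\<dots> = lc (\<preceq>) f * lc (\<preceq>) g"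
    by (simp add: sum.delta lc_def in_keys_iff)
  finally show ?thesis .
qed

lemma mult_nonzero:
  fixes f g :: "('x, 'a::idom) mpoly"
  assumes "f \<noteq> 0" "g \<noteq> 0"
  shows "f * g \<noteq> 0"
  using lookup_mult_lm[of f g] lc_nonzero assms by (metis lookup_zero mult_eq_0_iff)

lemma prod_nonzero:
  fixes f :: "'i \<Rightarrow> ('x, 'a::idom) mpoly"
  shows "(\<And>i. i \<in> A \<Longrightarrow> f i \<noteq> 0) \<Longrightarrow> prod f A \<noteq> 0"
  by (induction A rule: infinite_finite_induct) (simp_all add: mult_nonzero)

text \<open>One step of polynomial division: the multiple of \<open>g\<close> has the leading term
  of \<open>f\<close>, which cancels, and its other monomials lie below \<open>lm f\<close>.\<close>

lemma lm_reduce: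
  fixes f g :: "('x, 'a::field) mpoly"
  assumes "f \<noteq> 0" "g \<noteq> 0" "lm f = u + lm g"
    and "f' = f - Poly_Mapping.single u (lc (\<preceq>) f / lc (\<preceq>) g) * g" "f' \<noteq> 0"
  shows "lm f' \<preceq> lm f" "lm f' \<noteq> lm f"
proof -
  have "s \<preceq> lm f" if "s \<in> Poly_Mapping.keys f'" for s
  proof -
    have "s \<in> Poly_Mapping.keys f \<or> s \<in> (+) u ` Poly_Mapping.keys g"
      using that assms(4) keys_diff[of f] keys_single_times by blast
    then show ?thesis
      unfolding assms(3)[symmetric] using assms(3) lm_max[of _ f] lm_max[of _ g] add_mono_left by fastforce
  qed
  then show "lm f' \<preceq> lm f"
    using lm_in_keys[OF assms(5)] by blast
  have "Poly_Mapping.lookup f' (lm f) = 0"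
    using lookup_single_times[of u "lc (\<preceq>) f / lc (\<preceq>) g" g "lm g"] lc_nonzero[OF assms(2)]
    by (simp add: assms(3,4) lookup_minus flip: lc_def) (simp add: lc_def assms(3))
  then show "lm f' \<noteq> lm f"
    using lm_in_keys[OF assms(5)] by (metis in_keys_iff)
qed

text \<open>Well-founded induction on leading monomials. The induction hypothesis covers nonzero
  \<open>g\<close> only, since \<open>lm 0\<close> is unspecified; a zero remainder is treated
  separately at each use.\<close>

lemma lm_induct [case_names less]:
  assumes "\<And>f. (\<And>g. g \<noteq> 0 \<Longrightarrow> lm g \<preceq> lm f \<Longrightarrow> lm g \<noteq> lm f \<Longrightarrow> P g) \<Longrightarrow> P f"
  shows "P f"
proof -
  have "wf (inv_image {(s, t). s \<preceq> t \<and> s \<noteq> t} lm)"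
    using wf_preceq by simp
  then show ?thesis
    by (induction f rule: wf_induct_rule) (rule assms, auto)
qed

end

section \<open>Groebner bases: division, finite generation and uniqueness\<close>

context monomial_ordering
begin

text \<open>The Groebner basis property in terms of divisibility of leading monomials. Finiteness is
  left out, and zero elements of \<open>G\<close> are harmless.\<close>

definition lm_generates :: "('x, 'a::field) mpoly set \<Rightarrow> ('x, 'a) mpoly set \<Rightarrow> bool"
  where "lm_generates G I \<longleftrightarrow> G \<subseteq> I \<and>
    (\<forall>f\<in>I. f \<noteq> 0 \<longrightarrow> (\<exists>g\<in>G. g \<noteq> 0 \<and> (\<exists>u. lm f = u + lm g)))"

lemma lm_generatesE:
  assumes "lm_generates G I" "f \<in> I" "f \<noteq> 0"
  obtains g u where "g \<in> G" "g \<in> I" "g \<noteq> 0" "lm f = u + lm g"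
  using assms unfolding lm_generates_def by blast

lemma groebner_basis_lm_generates:
  assumes "groebner_basis (\<preceq>) G I"
  shows "lm_generates G I"
proof -
  have "\<exists>g\<in>G. g \<noteq> 0 \<and> (\<exists>u. lm f = u + lm g)" if f: "f \<in> I" "f \<noteq> 0" for f
  proof -
    have "lead_term (\<preceq>) f \<in> ideals.span (lead_term (\<preceq>) ` I)"
      using f(1) by (intro ideals.span_base) simp
    then have "lead_term (\<preceq>) f \<in> ideals.span ((\<lambda>g. Poly_Mapping.single (lm g) (lc (\<preceq>) g)) ` G)"
      using assms by (simp add: groebner_basis_def genideal_eq_span lead_term_def[abs_def])
    moreover have "lm f \<in> Poly_Mapping.keys (lead_term (\<preceq>) f)"
      using lc_nonzero[OF f(2)] by (simp add: lead_term_def)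
    ultimately obtain g u where "g \<in> G" "lc (\<preceq>) g \<noteq> 0" "lm f = u + lm g"
      using keys_monomial_ideal by blast
    then show ?thesis
      by (metis lc_def lookup_zero)
  qed
  then show ?thesis
    using assms by (auto simp: lm_generates_def groebner_basis_def)
qed

text \<open>The division algorithm: subtracting a multiple of an element of \<open>G\<close> lowers
  the leading monomial and stays inside \<open>I\<close>.\<close>

lemma lm_generates_span:
  assumes "lm_generates G I" "ideals.subspace I"
  shows "ideals.span G = I"
proof
  show "ideals.span G \<subseteq> I"
    using assms by (intro ideals.span_minimal) (auto simp: lm_generates_def)
  have "f \<in> I \<longrightarrow> f \<in> ideals.span G" for f
  proof (induction f rule: lm_induct)
    case (less f)
    show ?case
    proof (cases "f \<in> I \<and> f \<noteq> 0")
      case True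
      then obtain g u where g: "g \<in> G" "g \<in> I" "g \<noteq> 0" "lm f = u + lm g"
        using lm_generatesE assms(1) by metis
      let ?q = "Poly_Mapping.single u (lc (\<preceq>) f / lc (\<preceq>) g)"
      let ?r = "f - ?q * g"
      have "?r \<in> I"
        using True g(2) assms(2) ideals.subspace_diff ideals.subspace_scale by blast
      moreover have "?r \<noteq> 0 \<Longrightarrow> lm ?r \<preceq> lm f \<and> lm ?r \<noteq> lm f"
        using lm_reduce[OF _ g(3,4) refl] True by blast
      ultimately have "?r \<in> ideals.span G"
        using less by (cases "?r = 0") (auto simp: ideals.span_zero)
      then have "?r + ?q * g \<in> ideals.span G"
        by (rule ideals.span_add[OF _ ideals.span_scale[OF ideals.span_base[OF g(1)]]])
      then show ?thesis
        by simp
    qed (auto simp: ideals.span_zero)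
  qed
  then show "I \<subseteq> ideals.span G"
    by blast
qed

lemma exists_lm_generates:
  fixes I :: "('x, 'a::field) mpoly set"
  obtains G where "finite G" "lm_generates G I"
proof -
  obtain T where T: "finite T" "T \<subseteq> lm ` (I - {0})" "\<And>t. t \<in> lm ` (I - {0}) \<Longrightarrow> \<exists>s\<in>T. \<exists>u. t = u + s"
    using dickson_finite[of "lm ` (I - {0})"] by metis
  obtain G where "finite G" "G \<subseteq> I - {0}" "T = lm ` G"
    using finite_subset_image[OF T(1,2)] by blast
  with T(3) that[of G] show ?thesis
    by (fastforce simp: lm_generates_def)
qed

text \<open>Hilbert's basis theorem, with the generators taken from \<open>B\<close> itself: each of
  the finitely many elements of a Groebner basis of the span involves only finitely many elements of
  \<open>B\<close>.\<close>

lemma noetherian: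
  fixes B :: "('x, 'a::field) mpoly set"
  obtains B0 where "finite B0" "B0 \<subseteq> B" "B \<subseteq> ideals.span B0"
proof -
  obtain G where G: "finite G" "lm_generates G (ideals.span B)"
    using exists_lm_generates .
  have "\<exists>S. finite S \<and> S \<subseteq> B \<and> g \<in> ideals.span S" if "g \<in> G" for g
  proof -
    have "g \<in> ideals.span B"
      using that G(2) by (auto simp: lm_generates_def)
    then obtain S r where "finite S" "S \<subseteq> B" "g = (\<Sum>a\<in>S. r a * a)"
      unfolding ideals.span_explicit by auto
    moreover have "(\<Sum>a\<in>S. r a * a) \<in> ideals.span S"
      by (rule ideals.span_sum) (rule ideals.span_scale[OF ideals.span_base])
    ultimately show ?thesis
      by blast
  qed
  then obtain S where S: "\<And>g. g \<in> G \<Longrightarrow> finite (S g) \<and> S g \<subseteq> B \<and> g \<in> ideals.span (S g)"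
    by metis
  have "G \<subseteq> ideals.span (\<Union> (S ` G))"
    using S ideals.span_mono[of "S _" "\<Union> (S ` G)"] by blast
  then have "ideals.span G \<subseteq> ideals.span (\<Union> (S ` G))"
    by (intro ideals.span_minimal) auto
  then have "B \<subseteq> ideals.span (\<Union> (S ` G))"
    using lm_generates_span[OF G(2)] ideals.span_superset by auto
  then show ?thesis
    using that[of "\<Union> (S ` G)"] S G(1) by auto
qed

text \<open>One half of the uniqueness of reduced Groebner bases. For \<open>g\<close> in
  \<open>G\<close>, some \<open>lm l\<close> divides \<open>lm g\<close> and some
  \<open>lm g'\<close> divides \<open>lm l\<close>; reducedness forces \<open>g' = g\<close>, so
  that \<open>lm l = lm g\<close>, and it remains to show \<open>g = l\<close>.\<close>

lemma reduced_groebner_basis_subset: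
  fixes G L I :: "('x, 'a::field) mpoly set"
  assumes G: "reduced_groebner_basis (\<preceq>) G I" and L: "reduced_groebner_basis (\<preceq>) L I"
    and I: "ideals.subspace I"
  shows "G \<subseteq> L"
proof
  fix g assume g: "g \<in> G"
  have nz: "h \<noteq> 0" if "h \<in> G \<or> h \<in> L" for h
    using that G L unfolding reduced_groebner_basis_def
    by (metis lc_def lookup_zero zero_neq_one)
  have gen: "lm_generates G I" "lm_generates L I"
    using G L groebner_basis_lm_generates by (auto simp: reduced_groebner_basis_def)
  have red: "g1 = g2" if H: "reduced_groebner_basis (\<preceq>) H I" and "g1 \<in> H" "g2 \<in> H" "t \<in> Poly_Mapping.keys g1" "t = u + lm g2"
    for g1 g2 t u H
  proof (rule ccontr)
    assume "g1 \<noteq> g2"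
    then have "lead_term (\<preceq>) g2 \<in> ideals.span (lead_term (\<preceq>) ` (H - {g1}))"
      using that by (intro ideals.span_base) auto
    moreover have "lc (\<preceq>) g2 = 1"
      using that by (auto simp: reduced_groebner_basis_def)
    ultimately have "Poly_Mapping.single (lm g2 + u) 1 \<in> ideals.span (lead_term (\<preceq>) ` (H - {g1}))"
      by (intro single_in_ideal[where c = 1]) (auto simp: lead_term_def)
    then show False
      using that by (auto simp: reduced_groebner_basis_def genideal_eq_span add.commute)
  qed
  have gI: "g \<in> I"
    using g gen(1) by (auto simp: lm_generates_def)
  obtain l u where l: "l \<in> L" "l \<in> I" "lm g = u + lm l"
    using lm_generatesE[OF gen(2) gI] nz g by metis
  obtain g' v where g': "g' \<in> G" "lm l = v + lm g'"
    using lm_generatesE[OF gen(1) l(2)] nz l(1) by metis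
  have "g' = g"
    using red[OF G g g'(1) lm_in_keys, of "u + v"] nz g l(3) g'(2) by (auto simp: add.assoc)
  then have "lm l \<preceq> lm g" "lm g \<preceq> lm l"
    using l(3) g'(2) preceq_add[of "lm l" u] preceq_add[of "lm g" v] by auto
  then have lm_eq: "lm l = lm g"
    by (rule mo.order_antisym)
  have "g = l"
  \<comment> \<open>The common leading term cancels in \<open>g - l\<close>. The leading monomial of
    this difference is thus a lower monomial of \<open>g\<close> or of \<open>l\<close>, yet
    divisible by a leading monomial of the respective basis, against reducedness.\<close>
  proof (rule ccontr)
    assume ne: "g \<noteq> l"
    let ?d = "g - l"
    have d: "?d \<in> I" "?d \<noteq> 0"
      using gI l(2) I ne ideals.subspace_diff by auto
    have "Poly_Mapping.lookup g (lm g) = 1" "Poly_Mapping.lookup l (lm g) = 1"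
      using G L g l(1) lm_eq by (auto simp: reduced_groebner_basis_def lc_def)
    then have "Poly_Mapping.lookup ?d (lm g) = 0"
      by (simp add: lookup_minus)
    then have lmd: "lm ?d \<noteq> lm g"
      using lm_in_keys[OF d(2)] by (metis in_keys_iff)
    have "lm ?d \<in> Poly_Mapping.keys g \<or> lm ?d \<in> Poly_Mapping.keys l"
      using lm_in_keys[OF d(2)] keys_diff by fastforce
    then show False
    proof
      assume *: "lm ?d \<in> Poly_Mapping.keys g"
      obtain g2 w where g2: "g2 \<in> G" "lm ?d = w + lm g2"
        using lm_generatesE[OF gen(1) d] by metis
      then have "g = g2"
        using red[OF G g g2(1) *] by blast
      then show False
        using lmd lm_max[OF *] g2(2) preceq_add[of "lm g" w] mo.order_antisym by metis
    next
      assume *: "lm ?d \<in> Poly_Mapping.keys l"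
      obtain g2 w where g2: "g2 \<in> L" "lm ?d = w + lm g2"
        using lm_generatesE[OF gen(2) d] by metis
      then have "l = g2"
        using red[OF L l(1) g2(1) *] by blast
      then show False
        using lmd lm_max[OF *] g2(2) preceq_add[of "lm g" w] mo.order_antisym lm_eq by metis
    qed
  qed
  then show "g \<in> L"
    using l(1) by simp
qed

lemma reduced_groebner_basis_unique:
  fixes G L I :: "('x, 'a::field) mpoly set"
  assumes "reduced_groebner_basis (\<preceq>) G I" "reduced_groebner_basis (\<preceq>) L I" "ideals.subspace I"
  shows "G = L"
  using reduced_groebner_basis_subset assms by blast

end

section \<open>Reduction modulo a prime\<close>

lemma of_int_mod_ring_eq_0_iff:
  "(of_int n :: 'p::prime_card mod_ring) = 0 \<longleftrightarrow> int CARD('p) dvd n"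
  by (simp add: of_int_eq_0_iff_char_dvd)

text \<open>The reduced denominator divides every other denominator of the same number, so it
  suffices to test that one.\<close>

lemma Z_loc_iff:
  assumes "prime p"
  shows "r \<in> Z_loc p \<longleftrightarrow> \<not> int p dvd snd (quotient_of r)"
proof
  assume "r \<in> Z_loc p"
  then obtain a b where r: "r = of_int a / of_int b" and b: "\<not> int p dvd b"
    by (auto simp: Z_loc_def)
  obtain n d where nd: "quotient_of r = (n, d)"
    by (cases "quotient_of r")
  have "b \<noteq> 0"
    using b by auto
  have "(of_int (n * b) :: rat) = of_int (a * d)"
    using quotient_of_div[OF nd] quotient_of_denom_pos[OF nd] r \<open>b \<noteq> 0\<close> by (simp add: field_simps)
  then have "n * b = a * d"
    by (rule of_int_eq_iff[THEN iffD1])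
  then have "d dvd b"
    using quotient_of_coprime[OF nd] by (metis coprime_commute coprime_dvd_mult_right_iff dvd_triv_right)
  then show "\<not> int p dvd snd (quotient_of r)"
    using b nd by (auto intro: dvd_trans)
next
  assume *: "\<not> int p dvd snd (quotient_of r)"
  obtain n d where nd: "quotient_of r = (n, d)"
    by (cases "quotient_of r")
  then show "r \<in> Z_loc p"
    using * quotient_of_div[OF nd] by (auto simp: Z_loc_def)
qed

text \<open>Frees \<open>phi_coeff\<close> from the reduced fraction in its definition: after
  cross-multiplication, any denominator prime to \<open>p\<close> gives the same residue.\<close>

lemma phi_coeff_of_int_div:
  assumes "\<not> int CARD('p) dvd b"
  shows "phi_coeff (of_int a / of_int b) = (of_int a / of_int b :: 'p::prime_card mod_ring)"
proof -
  let ?r = "of_int a / of_int b :: rat"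
  obtain n d where nd: "quotient_of ?r = (n, d)"
    by (cases "quotient_of ?r")
  have "?r \<in> Z_loc CARD('p)"
    using assms by (auto simp: Z_loc_def)
  then have d: "\<not> int CARD('p) dvd d"
    using Z_loc_iff[OF prime_card[where ?'a = 'p]] nd by simp
  have "b \<noteq> 0"
    using assms by auto
  then have "(of_int (n * b) :: rat) = of_int (a * d)"
    using quotient_of_div[OF nd] quotient_of_denom_pos[OF nd] by (simp add: field_simps)
  then have "n * b = a * d"
    by (rule of_int_eq_iff[THEN iffD1])
  then have "(of_int n * of_int b :: 'p mod_ring) = of_int a * of_int d"
    by (metis of_int_mult)
  then show ?thesis
    using assms d nd
    by (simp add: phi_coeff_def frac_eq_eq of_int_mod_ring_eq_0_iff[where ?'p = 'p, symmetric])
qed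

lemma Z_locE:
  assumes "r \<in> Z_loc p"
  obtains a b where "r = of_int a / of_int b" "\<not> int p dvd b" "b \<noteq> 0"
  using assms by (auto simp: Z_loc_def)

context
  fixes p :: nat
  assumes p: "prime p"
begin

lemma Z_loc_of_int: "of_int n \<in> Z_loc p"
proof -
  have "(of_int n :: rat) = of_int n / of_int 1 \<and> \<not> int p dvd 1"
    using p by (auto dest: prime_gt_1_nat)
  then show ?thesis
    unfolding Z_loc_def by blast
qed

lemma Z_loc_add: "r \<in> Z_loc p \<Longrightarrow> s \<in> Z_loc p \<Longrightarrow> r + s \<in> Z_loc p"
proof -
  assume rs: "r \<in> Z_loc p" "s \<in> Z_loc p"
  obtain a b where r: "r = of_int a / of_int b" "\<not> int p dvd b" "b \<noteq> 0"
    using rs(1) by (rule Z_locE)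
  obtain c d where s: "s = of_int c / of_int d" "\<not> int p dvd d" "d \<noteq> 0"
    using rs(2) by (rule Z_locE)
  have "r + s = of_int (a * d + c * b) / of_int (b * d)"
    using r s by (simp add: field_simps)
  moreover have "\<not> int p dvd b * d"
    using r s p by (simp add: prime_dvd_mult_iff)
  ultimately show ?thesis
    unfolding Z_loc_def by blast
qed

lemma Z_loc_mult: "r \<in> Z_loc p \<Longrightarrow> s \<in> Z_loc p \<Longrightarrow> r * s \<in> Z_loc p"
proof -
  assume rs: "r \<in> Z_loc p" "s \<in> Z_loc p"
  obtain a b where r: "r = of_int a / of_int b" "\<not> int p dvd b" "b \<noteq> 0"
    using rs(1) by (rule Z_locE)
  obtain c d where s: "s = of_int c / of_int d" "\<not> int p dvd d" "d \<noteq> 0"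
    using rs(2) by (rule Z_locE)
  have "r * s = of_int (a * c) / of_int (b * d)"
    using r s by (simp add: field_simps)
  moreover have "\<not> int p dvd b * d"
    using r s p by (simp add: prime_dvd_mult_iff)
  ultimately show ?thesis
    unfolding Z_loc_def by blast
qed

lemma Z_loc_uminus: "r \<in> Z_loc p \<Longrightarrow> - r \<in> Z_loc p"
  using Z_loc_mult[OF Z_loc_of_int[of "- 1"], of r] by simp

text \<open>The localization is a valuation ring: \<open>p\<close> cannot divide both the numerator
  and the denominator of a reduced fraction.\<close>

lemma Z_loc_divides_or:
  assumes "x \<noteq> 0" "y \<noteq> 0"
  shows "x / y \<in> Z_loc p \<or> y / x \<in> Z_loc p"
proof -
  obtain n d where nd: "quotient_of (x / y) = (n, d)"
    by (cases "quotient_of (x / y)")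
  have "x / y = of_int n / of_int d"
    by (rule quotient_of_div[OF nd])
  moreover from this have "y / x = of_int d / of_int n"
    by (metis inverse_divide)
  moreover have "\<not> int p dvd n \<or> \<not> int p dvd d"
    using quotient_of_coprime[OF nd] p
    by (metis coprime_common_divisor not_prime_unit prime_nat_int_transfer)
  ultimately show ?thesis
    unfolding Z_loc_def by blast
qed

text \<open>Divisibility in a valuation ring is total, so a finite set has an element of least
  valuation.\<close>

lemma Z_loc_common_divisor:
  assumes "finite A" "A \<noteq> {}" "0 \<notin> A"
  shows "\<exists>a\<in>A. \<forall>b\<in>A. b / a \<in> Z_loc p"
  using assms
proof (induction rule: finite_ne_induct)
  case (singleton x)
  then show ?case
    using Z_loc_of_int[of 1] by simp
next
  case (insert x A)
  then obtain a where a: "a \<in> A" "\<forall>b\<in>A. b / a \<in> Z_loc p" "a \<noteq> 0" "x \<noteq> 0"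
    by auto
  show ?case
  proof (cases "x / a \<in> Z_loc p")
    case False
    then have "a / x \<in> Z_loc p"
      using Z_loc_divides_or a by blast
    then have "b / x \<in> Z_loc p" if "b \<in> A" for b
      using that a Z_loc_mult[of "b / a" "a / x"] by auto
    then show ?thesis
      using Z_loc_of_int[of 1] a by auto
  qed (use a in auto)
qed

end

section \<open>Reduction of coefficients as a ring homomorphism\<close>

context
  fixes dummy :: "'p::prime_card itself"
begin

lemma phi_coeff_0 [simp]: "phi_coeff 0 = (0 :: 'p mod_ring)"
  by (simp add: phi_coeff_def)

lemma phi_coeff_1 [simp]: "phi_coeff 1 = (1 :: 'p mod_ring)"
  by (simp add: phi_coeff_def)

lemma
  assumes "r \<in> Z_loc CARD('p)" "s \<in> Z_loc CARD('p)"
  shows phi_coeff_add: "phi_coeff (r + s) = (phi_coeff r + phi_coeff s :: 'p mod_ring)"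
    and phi_coeff_mult: "phi_coeff (r * s) = (phi_coeff r * phi_coeff s :: 'p mod_ring)"
proof -
  obtain a b where r: "r = of_int a / of_int b" "\<not> int CARD('p) dvd b" "b \<noteq> 0"
    using assms(1) by (rule Z_locE)
  obtain c d where s: "s = of_int c / of_int d" "\<not> int CARD('p) dvd d" "d \<noteq> 0"
    using assms(2) by (rule Z_locE)
  have bd: "\<not> int CARD('p) dvd b * d"
    using r s prime_card_int[where ?'a = 'p] by (simp add: prime_dvd_mult_iff)
  have nz: "(of_int b :: 'p mod_ring) \<noteq> 0" "(of_int d :: 'p mod_ring) \<noteq> 0"
    using r s by (simp_all add: of_int_mod_ring_eq_0_iff)
  have eq: "r + s = of_int (a * d + c * b) / of_int (b * d)" "r * s = of_int (a * c) / of_int (b * d)"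
    using r(3) s(3) unfolding r(1) s(1) by (simp_all add: add_frac_eq mult.commute)
  show "phi_coeff (r + s) = (phi_coeff r + phi_coeff s :: 'p mod_ring)"
    unfolding eq unfolding r(1) s(1) phi_coeff_of_int_div[OF bd] phi_coeff_of_int_div[OF r(2)]
      phi_coeff_of_int_div[OF s(2)] using nz by (simp add: add_frac_eq mult.commute)
  show "phi_coeff (r * s) = (phi_coeff r * phi_coeff s :: 'p mod_ring)"
    unfolding eq unfolding r(1) s(1) phi_coeff_of_int_div[OF bd] phi_coeff_of_int_div[OF r(2)]
      phi_coeff_of_int_div[OF s(2)] using nz by (simp add: add_frac_eq mult.commute)
qed

lemma inverse_in_Z_loc:
  assumes "r \<in> Z_loc CARD('p)" "phi_coeff r \<noteq> (0 :: 'p mod_ring)"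
  shows "inverse r \<in> Z_loc CARD('p)"
proof -
  obtain a b where r: "r = of_int a / of_int b" "\<not> int CARD('p) dvd b" "b \<noteq> 0"
    using assms Z_locE by metis
  then have "(of_int a :: 'p mod_ring) \<noteq> 0"
    using assms(2) phi_coeff_of_int_div[OF r(2)] by auto
  then have "\<not> int CARD('p) dvd a"
    by (simp add: of_int_mod_ring_eq_0_iff)
  moreover have "inverse r = of_int b / of_int a"
    using r by simp
  ultimately show ?thesis
    unfolding Z_loc_def by blast
qed

lemma lookup_phi: "Poly_Mapping.lookup (phi f) t = (phi_coeff (Poly_Mapping.lookup f t) :: 'p mod_ring)"
  by (simp add: phi_def map.rep_eq when_def)

lemma keys_phi: "Poly_Mapping.keys (phi f :: ('x, 'p mod_ring) mpoly) \<subseteq> Poly_Mapping.keys f"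
  by (auto simp: in_keys_iff lookup_phi)

lemma phi_0 [simp]: "phi 0 = (0 :: ('x, 'p mod_ring) mpoly)"
  by (rule poly_mapping_eqI) (simp add: lookup_phi)

lemma phi_single: "phi (Poly_Mapping.single t c) = (Poly_Mapping.single t (phi_coeff c) :: ('x, 'p mod_ring) mpoly)"
  by (rule poly_mapping_eqI) (simp add: lookup_phi lookup_single when_def)

lemma phi_add:
  assumes "f \<in> Z_loc_polys CARD('p)" "g \<in> Z_loc_polys CARD('p)"
  shows "phi (f + g) = (phi f + phi g :: ('x, 'p mod_ring) mpoly)"
  using assms by (intro poly_mapping_eqI) (simp add: lookup_phi lookup_add phi_coeff_add Z_loc_polys_def)

lemma Z_loc_polys_add:
  "f \<in> Z_loc_polys CARD('p) \<Longrightarrow> g \<in> Z_loc_polys CARD('p) \<Longrightarrow> f + g \<in> Z_loc_polys CARD('p)"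
  using Z_loc_add[OF prime_card] by (auto simp: Z_loc_polys_def lookup_add)

lemma Z_loc_polys_0: "0 \<in> Z_loc_polys CARD('p)"
  using Z_loc_of_int[OF prime_card[where ?'a = 'p], of 0] by (auto simp: Z_loc_polys_def)

lemma Z_loc_polys_single: "c \<in> Z_loc CARD('p) \<Longrightarrow> Poly_Mapping.single t c \<in> Z_loc_polys CARD('p)"
  using Z_loc_of_int[OF prime_card[where ?'a = 'p], of 0]
  by (auto simp: Z_loc_polys_def lookup_single when_def)

lemma
  assumes "\<And>i. i \<in> A \<Longrightarrow> f i \<in> Z_loc_polys CARD('p)"
  shows Z_loc_polys_sum: "sum f A \<in> Z_loc_polys CARD('p)"
    and phi_sum: "phi (sum f A) = (\<Sum>i\<in>A. phi (f i) :: ('x, 'p mod_ring) mpoly)"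
proof -
  have "sum f A \<in> Z_loc_polys CARD('p) \<and> phi (sum f A) = (\<Sum>i\<in>A. phi (f i) :: ('x, 'p mod_ring) mpoly)"
    using assms
    by (induction A rule: infinite_finite_induct) (auto simp: Z_loc_polys_0 Z_loc_polys_add phi_add)
  then show "sum f A \<in> Z_loc_polys CARD('p)" "phi (sum f A) = (\<Sum>i\<in>A. phi (f i) :: ('x, 'p mod_ring) mpoly)"
    by auto
qed

lemma
  fixes f g :: "('x, rat) mpoly"
  assumes "f \<in> Z_loc_polys CARD('p)" "g \<in> Z_loc_polys CARD('p)"
  shows Z_loc_polys_mult: "f * g \<in> Z_loc_polys CARD('p)"
    and phi_mult: "phi (f * g) = (phi f * phi g :: ('x, 'p mod_ring) mpoly)"
proof -
  have *: "f * g = (\<Sum>a\<in>Poly_Mapping.keys f. \<Sum>b\<in>Poly_Mapping.keys g.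
    Poly_Mapping.single (a + b) (Poly_Mapping.lookup f a * Poly_Mapping.lookup g b))"
    by (subst poly_mapping_sum_single[of "Poly_Mapping.keys f" f])
      (simp_all add: sum_distrib_right single_times)
  have Z: "Poly_Mapping.single (a + b) (Poly_Mapping.lookup f a * Poly_Mapping.lookup g b) \<in> Z_loc_polys CARD('p)" for a b
    using assms by (intro Z_loc_polys_single Z_loc_mult[OF prime_card]) (auto simp: Z_loc_polys_def)
  show "f * g \<in> Z_loc_polys CARD('p)"
    unfolding * by (intro Z_loc_polys_sum Z)
  have "phi (f * g) = (\<Sum>a\<in>Poly_Mapping.keys f. \<Sum>b\<in>Poly_Mapping.keys g.
    Poly_Mapping.single (a + b) (phi_coeff (Poly_Mapping.lookup f a) * phi_coeff (Poly_Mapping.lookup g b) :: 'p mod_ring))"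
  proof -
    have "phi (f * g) = (\<Sum>a\<in>Poly_Mapping.keys f. \<Sum>b\<in>Poly_Mapping.keys g. phi (Poly_Mapping.single (a + b)
      (Poly_Mapping.lookup f a * Poly_Mapping.lookup g b)) :: ('x, 'p mod_ring) mpoly)"
      unfolding * by (simp only: phi_sum Z Z_loc_polys_sum)
    then show ?thesis
      using assms by (simp add: phi_single phi_coeff_mult Z_loc_polys_def)
  qed
  also have "\<dots> = (\<Sum>a\<in>Poly_Mapping.keys f. Poly_Mapping.single a (Poly_Mapping.lookup (phi f) a)) *
      (\<Sum>b\<in>Poly_Mapping.keys g. Poly_Mapping.single b (Poly_Mapping.lookup (phi g) b))"
    by (simp add: sum_product mult_single lookup_phi)
  also have "\<dots> = phi f * phi g"
    using poly_mapping_sum_single[of "Poly_Mapping.keys f" "phi f :: ('x, 'p mod_ring) mpoly"]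
      poly_mapping_sum_single[of "Poly_Mapping.keys g" "phi g :: ('x, 'p mod_ring) mpoly"] keys_phi
    by fastforce
  finally show "phi (f * g) = (phi f * phi g :: ('x, 'p mod_ring) mpoly)" .
qed

text \<open>Dividing by a coefficient of least valuation makes all coefficients integral at
  \<open>p\<close> and turns that one into 1, which survives reduction.\<close>

lemma exists_primitive_multiple:
  fixes h :: "('x, rat) mpoly"
  assumes "h \<noteq> 0"
  obtains c where "c \<noteq> 0" "Poly_Mapping.single 0 c * h \<in> Z_loc_polys CARD('p)"
    "phi (Poly_Mapping.single 0 c * h) \<noteq> (0 :: ('x, 'p mod_ring) mpoly)"
proof -
  let ?A = "Poly_Mapping.lookup h ` Poly_Mapping.keys h"
  have "\<exists>a\<in>?A. \<forall>b\<in>?A. b / a \<in> Z_loc CARD('p)"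
    by (rule Z_loc_common_divisor[OF prime_card]) (use assms in \<open>auto simp: in_keys_iff\<close>)
  then obtain t where t: "t \<in> Poly_Mapping.keys h"
    "\<And>s. s \<in> Poly_Mapping.keys h \<Longrightarrow> Poly_Mapping.lookup h s / Poly_Mapping.lookup h t \<in> Z_loc CARD('p)"
    by auto
  define c where "c = 1 / Poly_Mapping.lookup h t"
  have "c \<noteq> 0"
    using t(1) by (auto simp: c_def in_keys_iff)
  moreover have "Poly_Mapping.lookup (Poly_Mapping.single 0 c * h) s \<in> Z_loc CARD('p)" for s
    using t(2)[of s] Z_loc_of_int[OF prime_card[where ?'a = 'p], of 0]
    by (cases "s \<in> Poly_Mapping.keys h") (auto simp: lookup_const_times c_def in_keys_iff)
  moreover have "Poly_Mapping.lookup (phi (Poly_Mapping.single 0 c * h) :: ('x, 'p mod_ring) mpoly) t = 1"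
    using t(1) by (simp add: lookup_phi lookup_const_times c_def in_keys_iff)
  ultimately show ?thesis
    using that[of c] by (force simp: Z_loc_polys_def)
qed

end

section \<open>Reduction of Groebner bases\<close>

context monomial_ordering
begin

text \<open>Permissibility keeps the leading term alive, and reduction can only delete other
  monomials.\<close>

lemma lm_phi:
  assumes "permissible TYPE('p::prime_card) (\<preceq>) F" "f \<in> F"
  shows "lm (phi f :: ('x, 'p mod_ring) mpoly) = lm f" "f \<noteq> 0" "phi f \<noteq> (0 :: ('x, 'p mod_ring) mpoly)"
proof -
  have *: "Poly_Mapping.lookup (phi f :: ('x, 'p mod_ring) mpoly) (lm f) \<noteq> 0"
    using assms by (auto simp: permissible_def lookup_phi lc_def)
  then show "lm (phi f :: ('x, 'p mod_ring) mpoly) = lm f"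
  proof (intro lm_eqI)
    fix s assume "s \<in> Poly_Mapping.keys (phi f :: ('x, 'p mod_ring) mpoly)"
    then show "s \<preceq> lm f"
      using keys_phi[where ?'p = 'p, of f] lm_max by blast
  qed (simp add: in_keys_iff)
  show "f \<noteq> 0" "phi f \<noteq> (0 :: ('x, 'p mod_ring) mpoly)"
    using * by auto
qed

text \<open>Leading coefficients of \<open>F\<close> are units of the localization, so division of
  an integral \<open>f\<close> by \<open>F\<close> has integral quotients and remainders and can be
  reduced modulo \<open>p\<close> step by step.\<close>

lemma phi_in_I_p:
  assumes F: "groebner_basis (\<preceq>) F I" "permissible TYPE('p::prime_card) (\<preceq>) F"
    and I: "ideals.subspace I" and f: "f \<in> I" "f \<in> Z_loc_polys CARD('p)"
  shows "phi f \<in> (I_p F :: ('x, 'p mod_ring) mpoly set)"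
proof -
  have "f \<in> I \<longrightarrow> f \<in> Z_loc_polys CARD('p) \<longrightarrow> phi f \<in> (I_p F :: ('x, 'p mod_ring) mpoly set)" for f
  proof (induction f rule: lm_induct)
    case (less f)
    show ?case
    proof (intro impI)
      assume f: "f \<in> I" "f \<in> Z_loc_polys CARD('p)"
      show "phi f \<in> (I_p F :: ('x, 'p mod_ring) mpoly set)"
      proof (cases "f = 0")
        case False
        obtain g u where g: "g \<in> F" "g \<in> I" "g \<noteq> 0" "lm f = u + lm g"
          using lm_generatesE[OF groebner_basis_lm_generates[OF F(1)] f(1) False] .
        have gZ: "g \<in> Z_loc_polys CARD('p)" and "phi_coeff (lc (\<preceq>) g) \<noteq> (0 :: 'p mod_ring)"
          using F(2) g(1) by (auto simp: permissible_def)
        then have "inverse (lc (\<preceq>) g) \<in> Z_loc CARD('p)"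
          by (intro inverse_in_Z_loc) (auto simp: Z_loc_polys_def lc_def)
        moreover have "lc (\<preceq>) f \<in> Z_loc CARD('p)"
          using f(2) by (auto simp: Z_loc_polys_def lc_def)
        ultimately have c: "lc (\<preceq>) f / lc (\<preceq>) g \<in> Z_loc CARD('p)"
          using Z_loc_mult[OF prime_card] by (simp add: divide_inverse)
        define q where "q = Poly_Mapping.single u (lc (\<preceq>) f / lc (\<preceq>) g)"
        define r where "r = f - q * g"
        have q: "q \<in> Z_loc_polys CARD('p)" "- q \<in> Z_loc_polys CARD('p)"
          using c Z_loc_uminus[OF prime_card[where ?'a = 'p]]
          unfolding q_def by (auto intro!: Z_loc_polys_single simp: single_uminus[symmetric])
        have rI: "r \<in> I"
          unfolding r_def using f(1) g(2) I ideals.subspace_diff ideals.subspace_scale by blast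
        have rZ: "r \<in> Z_loc_polys CARD('p)"
          using Z_loc_polys_add[OF f(2) Z_loc_polys_mult[OF q(2) gZ]] by (simp add: r_def)
        have "r \<noteq> 0 \<Longrightarrow> lm r \<preceq> lm f \<and> lm r \<noteq> lm f"
          using lm_reduce[OF False g(3,4), of r] by (simp add: r_def q_def)
        then have "phi r \<in> (I_p F :: ('x, 'p mod_ring) mpoly set)"
          using less rI rZ by (cases "r = 0") (auto simp: I_p_def genideal_eq_span ideals.span_zero)
        moreover have "phi f = (phi r + phi q * phi g :: ('x, 'p mod_ring) mpoly)"
          using phi_add[OF rZ Z_loc_polys_mult[OF q(1) gZ]] phi_mult[OF q(1) gZ] by (simp add: r_def)
        ultimately show ?thesis
          using ideals.span_add[OF _ ideals.span_scale[OF ideals.span_base[OF imageI[OF g(1)]]]]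
          unfolding I_p_def genideal_eq_span by metis
      qed (simp add: I_p_def genideal_eq_span ideals.span_zero)
    qed
  qed
  then show ?thesis
    using f by blast
qed

end

section \<open>Weights representing the ordering on finitely many comparisons\<close>

lemma exists_between_finite:
  fixes A B :: "rat set"
  assumes "finite A" "finite B" "\<And>a b. a \<in> A \<Longrightarrow> b \<in> B \<Longrightarrow> a < b"
  obtains c where "\<forall>a\<in>A. a < c" "\<forall>b\<in>B. c < b"
proof (cases "A = {} \<or> B = {}")
  case False
  then have "Max A < Min B"
    using assms by simp
  then obtain c where "Max A < c" "c < Min B"
    using dense by blast
  then show ?thesis
    using that[of c] assms False by simp
next
  case True
  obtain c where "\<forall>a\<in>A. a < c"
    using assms(1) by (metis gt_ex Max_less_iff empty_iff)
  moreover obtain d where "\<forall>b\<in>B. d < b"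
    using assms(2) by (metis lt_ex Min_gr_iff empty_iff)
  ultimately show ?thesis
    using True that[of c] that[of d] by blast
qed

text \<open>Fourier--Motzkin elimination: the coordinates are eliminated one at a time.\<close>

lemma exists_positive_functional:
  fixes C :: "('x \<Rightarrow> int) set"
  assumes add: "\<And>u v. u \<in> C \<Longrightarrow> v \<in> C \<Longrightarrow> (\<lambda>x. u x + v x) \<in> C"
    and zero: "(\<lambda>_. 0) \<notin> C"
    and "finite Y" "finite T" "T \<subseteq> C" "\<And>v x. v \<in> T \<Longrightarrow> x \<notin> Y \<Longrightarrow> v x = 0"
  shows "\<exists>w :: 'x \<Rightarrow> rat. \<forall>v\<in>T. 0 < (\<Sum>x\<in>Y. w x * of_int (v x))"
  using assms(3-)
proof (induction Y arbitrary: T rule: finite_induct)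
  case empty
  \<comment> \<open>With no coordinate left, every vector of \<open>T\<close> is zero, and
    \<open>C\<close> omits zero.\<close>
  have "v = (\<lambda>_. 0)" if "v \<in> T" for v
    using empty(3)[OF that] by auto
  then have "T = {}"
    using zero empty(2) by blast
  then show ?case
    by simp
next
  case (insert x Y)
  \<comment> \<open>Closure under addition yields positive multiples only; \<open>Suc n\<close>
    keeps the multiplier away from 0.\<close>
  have scale: "(\<lambda>y. int (Suc n) * v y) \<in> C" if "v \<in> C" for n v
  proof (induction n)
    case (Suc n)
    then show ?case
      using add[OF Suc that] by (simp add: algebra_simps)
  qed (use that in simp)
  have scale: "(\<lambda>y. k * v y) \<in> C" if "v \<in> C" "k > 0" for k :: int and v
    using scale[OF that(1), of "nat k - 1"] that(2) by (simp add: Suc_nat_eq_nat_zadd1)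
  \<comment> \<open>For \<open>u\<close> in \<open>P\<close> and \<open>v\<close> in
    \<open>N\<close> this is a positive combination whose coordinate at \<open>x\<close>
    vanishes.\<close>
  define comb where "comb u v = (\<lambda>y. (- v x) * u y + u x * v y)" for u v :: "'x \<Rightarrow> int"
  define P where "P = {v \<in> T. v x > 0}"
  define N where "N = {v \<in> T. v x < 0}"
  define T' where "T' = {v \<in> T. v x = 0} \<union> (\<lambda>(u, v). comb u v) ` (P \<times> N)"
  have "comb u v \<in> C" if "u \<in> P" "v \<in> N" for u v
    using that insert.prems(2) unfolding comb_def P_def N_def by (intro add scale) auto
  then have "T' \<subseteq> C"
    using insert.prems(2) by (auto simp: T'_def)
  moreover have "finite T'"
    using insert.prems(1) by (simp add: T'_def P_def N_def)
  moreover have "v y = 0" if v: "v \<in> T'" and y: "y \<notin> Y" for v y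
  proof (cases "y = x")
    case True
    then show ?thesis
      using v by (auto simp: T'_def comb_def)
  next
    case False
    then have u: "u y = 0" if "u \<in> T" for u
      using insert.prems(3)[OF that] y by blast
    from v have "v \<in> T \<or> (\<exists>a\<in>T. \<exists>b\<in>T. v = comb a b)"
      by (auto simp: T'_def P_def N_def)
    then show ?thesis
    proof (elim disjE bexE)
      fix a b assume "a \<in> T" "b \<in> T" "v = comb a b"
      then show ?thesis
        using u[of a] u[of b] by (simp add: comb_def)
    qed (rule u)
  qed
  ultimately obtain w :: "'x \<Rightarrow> rat" where w: "\<forall>v\<in>T'. 0 < (\<Sum>y\<in>Y. w y * of_int (v y))"
    using insert.IH by blast
  define s where "s v = (\<Sum>y\<in>Y. w y * of_int (v y))" for v :: "'x \<Rightarrow> int"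
  \<comment> \<open>Positivity on \<open>P\<close> bounds the weight of \<open>x\<close> from below
    and positivity on \<open>N\<close> from above. Positivity on the combinations says that these
    bounds are compatible.\<close>
  have "- s u / of_int (u x) < s v / of_int (- v x)" if "u \<in> P" "v \<in> N" for u v
  proof -
    have "0 < s (comb u v)"
      using w that by (auto simp: T'_def s_def)
    also have "s (comb u v) = of_int (- v x) * s u + of_int (u x) * s v"
      by (simp add: s_def comb_def sum_distrib_left sum.distrib[symmetric] algebra_simps)
    finally show ?thesis
      using that by (simp add: P_def N_def field_simps)
  qed
  then obtain c where c: "\<forall>a\<in>(\<lambda>u. - s u / of_int (u x)) ` P. a < c"
      "\<forall>b\<in>(\<lambda>v. s v / of_int (- v x)) ` N. c < b"
    by (rule_tac exists_between_finite[of "(\<lambda>u. - s u / of_int (u x)) ` P" "(\<lambda>v. s v / of_int (- v x)) ` N"])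
      (use insert.prems(1) in \<open>auto simp: P_def N_def\<close>)
  have "0 < (\<Sum>y\<in>insert x Y. (w(x := c)) y * of_int (v y))" if "v \<in> T" for v
  proof -
    have "(\<Sum>y\<in>insert x Y. (w(x := c)) y * of_int (v y)) = c * of_int (v x) + s v"
      using insert.hyps by (auto simp: s_def intro!: sum.cong)
    moreover have "v \<in> P \<or> v \<in> N \<or> v x = 0"
      using that by (auto simp: P_def N_def)
    then have "0 < c * of_int (v x) + s v"
    proof (elim disjE)
      assume "v \<in> P"
      then show ?thesis
        using c(1) by (auto simp: P_def field_simps)
    next
      assume "v \<in> N"
      then show ?thesis
        using c(2) by (auto simp: N_def field_simps)
    next
      assume "v x = 0"
      then show ?thesis
        using w that by (auto simp: T'_def s_def)
    qed
    ultimately show ?thesis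
      by simp
  qed
  then show ?case
    by blast
qed

section \<open>Positive integral weights adapted to finitely many polynomials\<close>

definition weight :: "('x::finite \<Rightarrow> nat) \<Rightarrow> 'x monom \<Rightarrow> nat"
  where "weight w t = (\<Sum>x\<in>UNIV. w x * Poly_Mapping.lookup t x)"

lemma weight_add: "weight w (s + t) = weight w s + weight w t"
  by (simp add: weight_def lookup_add algebra_simps sum.distrib)

lemma finite_bounded_monoms: "finite {t :: 'x::finite monom. \<forall>x. Poly_Mapping.lookup t x \<le> b x}"
proof (rule finite_imageD[of Poly_Mapping.lookup])
  have "Poly_Mapping.lookup ` {t :: 'x monom. \<forall>x. Poly_Mapping.lookup t x \<le> b x} \<subseteq> Pi\<^sub>E UNIV (\<lambda>x. {..b x})"
    by (auto simp: PiE_def Pi_def)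
  then show "finite (Poly_Mapping.lookup ` {t :: 'x monom. \<forall>x. Poly_Mapping.lookup t x \<le> b x})"
    by (rule finite_subset) (simp add: finite_PiE)
qed (simp add: inj_on_def)

lemma finite_weight_le:
  fixes w :: "'x::finite \<Rightarrow> nat"
  assumes "\<And>x. w x > 0"
  shows "finite {t. weight w t \<le> D}"
proof (rule finite_subset[OF _ finite_bounded_monoms[of "\<lambda>_. D"]], safe)
  fix t x assume "weight w t \<le> D"
  have "Poly_Mapping.lookup t x \<le> w x * Poly_Mapping.lookup t x"
    using assms[of x] by simp
  also have "\<dots> \<le> weight w t"
    unfolding weight_def by (rule member_le_sum) auto
  finally show "Poly_Mapping.lookup t x \<le> D"
    using \<open>weight w t \<le> D\<close> by simp
qed

lemma rat_common_denominator:
  fixes w :: "'x::finite \<Rightarrow> rat"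
  assumes "\<And>x. w x > 0"
  obtains D k where "D > 0" "\<And>x. D * w x = of_nat (k x)" "\<And>x. k x > 0"
proof -
  define d where "d x = snd (quotient_of (w x))" for x
  define D where "D = (\<Prod>x\<in>UNIV. d x)"
  have d: "d x > 0" for x
    by (simp add: d_def quotient_of_denom_pos')
  then have D: "D > 0"
    by (simp add: D_def prod_pos)
  have "\<exists>k::nat. of_int D * w x = of_nat k" for x
  proof -
    have w: "w x = of_int (fst (quotient_of (w x))) / of_int (d x)"
      using quotient_of_div[of "w x"] by (simp add: d_def)
    have "d x dvd D"
      unfolding D_def by (rule dvd_prodI) simp_all
    then obtain e where e: "D = d x * e"
      by blast
    define z where "z = e * fst (quotient_of (w x))"
    have z: "of_int D * w x = of_int z"
      using d[of x] by (subst w) (simp add: e z_def)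
    then have "of_int z > (0::rat)"
      using D assms[of x] by (metis mult_pos_pos of_int_0_less_iff)
    then have "of_int D * w x = of_nat (nat z)"
      using z by simp
    then show ?thesis
      by blast
  qed
  then obtain k where k: "\<And>x. of_int D * w x = (of_nat (k x) :: rat)"
    by metis
  have "(of_nat (k x) :: rat) > 0" for x
    using D assms[of x] by (subst k[symmetric]) simp
  then show ?thesis
    using that[of "of_int D" k] D k by simp
qed

context monomial_ordering
begin

text \<open>Differences of strictly comparable exponent vectors are closed under addition and never
  zero, so finitely many of them are positive under one rational functional; clearing denominators
  makes it integral.\<close>

lemma exists_weights:
  fixes H :: "('x, 'a::zero) mpoly set"
  assumes "finite H"
  obtains w :: "'x \<Rightarrow> nat" where "\<And>x. w x > 0"
    "\<And>h s. h \<in> H \<Longrightarrow> s \<in> Poly_Mapping.keys h \<Longrightarrow> s \<noteq> lm h \<Longrightarrow> weight w s < weight w (lm h)"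
proof -
  define dif where "dif s t = (\<lambda>x. int (Poly_Mapping.lookup t x) - int (Poly_Mapping.lookup s x))" for s t :: "'x monom"
  define C where "C = {dif s t | s t. s \<preceq> t \<and> s \<noteq> t}"
  \<comment> \<open>Besides the comparisons inside \<open>H\<close>, comparing 0 with each variable
    forces the weights themselves to be positive.\<close>
  define S where "S = (\<Union>h\<in>H. (\<lambda>s. (s, lm h)) ` (Poly_Mapping.keys h - {lm h})) \<union>
    (\<lambda>x. (0, Poly_Mapping.single x 1)) ` UNIV"
  have fin: "finite S"
    using assms by (simp add: S_def)
  have S: "s \<preceq> t \<and> s \<noteq> t" if "(s, t) \<in> S" for s t
  proof -
    have "Poly_Mapping.single x (Suc 0) \<noteq> 0" for x :: 'x
      by (metis lookup_single_eq lookup_zero nat.distinct(1))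
    then show ?thesis
      using that lm_max zero_preceq by (auto simp: S_def)
  qed
  have "(\<lambda>x. u x + v x) \<in> C" if uv: "u \<in> C" "v \<in> C" for u v
  proof -
    obtain s t s' t' where st: "u = dif s t" "s \<preceq> t" "s \<noteq> t" "v = dif s' t'" "s' \<preceq> t'" "s' \<noteq> t'"
      using uv by (auto simp: C_def)
    have "(\<lambda>x. u x + v x) = dif (s + s') (t + t')"
      using st by (auto simp: dif_def lookup_add)
    moreover have "s + s' \<preceq> t + t'"
      using add_mono_right[OF st(2)] add_mono_left[OF st(5)] mo.order_trans by blast
    moreover have "s + s' \<noteq> t + t'"
      using add_eq_top[OF st(2,5)] st by blast
    ultimately show ?thesis
      unfolding C_def by blast
  qed
  moreover have "(\<lambda>_. 0) \<notin> C"
    by (auto simp: C_def dif_def fun_eq_iff intro: poly_mapping_eqI)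
  moreover have "(\<lambda>(s, t). dif s t) ` S \<subseteq> C"
  proof (rule subsetI)
    fix v assume "v \<in> (\<lambda>(s, t). dif s t) ` S"
    then obtain s t where "v = dif s t" "(s, t) \<in> S"
      by auto
    then show "v \<in> C"
      using S unfolding C_def by blast
  qed
  ultimately obtain w :: "'x \<Rightarrow> rat" where
    "\<forall>v\<in>(\<lambda>(s, t). dif s t) ` S. 0 < (\<Sum>x\<in>UNIV. w x * of_int (v x))"
    using exists_positive_functional[of C UNIV "(\<lambda>(s, t). dif s t) ` S"] fin by auto
  then have w: "0 < (\<Sum>x\<in>UNIV. w x * of_int (dif s t x))" if "(s, t) \<in> S" for s t
    using that by fastforce
  have "w x > 0" for x
  proof -
    have "(\<Sum>y\<in>UNIV. w y * of_int (dif 0 (Poly_Mapping.single x 1) y)) = (\<Sum>y\<in>UNIV. if y = x then w y else 0)"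
      by (intro sum.cong) (auto simp: dif_def lookup_single when_def)
    then show ?thesis
      using w[of 0 "Poly_Mapping.single x 1"] by (simp add: S_def)
  qed
  then obtain D k where k: "D > 0" "\<And>x. D * w x = of_nat (k x)" "\<And>x. k x > 0"
    using rat_common_denominator[of w] by metis
  have "weight k s < weight k t" if "(s, t) \<in> S" for s t
  proof -
    have "0 < D * (\<Sum>x\<in>UNIV. w x * of_int (dif s t x))"
      using w[OF that] k(1) by simp
    also have "\<dots> = (\<Sum>x\<in>UNIV. of_nat (k x) * of_int (dif s t x))"
      by (simp add: sum_distrib_left k(2)[symmetric] mult.assoc)
    also have "\<dots> = of_nat (weight k t) - of_nat (weight k s)"
      by (simp add: weight_def dif_def algebra_simps sum_subtractf)
    finally show ?thesis
      by simp
  qed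
  then show ?thesis
    using that[of k] k(3) by (auto simp: S_def)
qed

text \<open>The monomials outside the ideal generated by the leading monomials of \<open>H\<close>.
  For a Groebner basis they represent a basis of the quotient.\<close>

definition standard :: "('x, 'a::zero) mpoly set \<Rightarrow> 'x monom \<Rightarrow> bool"
  where "standard H s \<longleftrightarrow> \<not> (\<exists>h\<in>H. h \<noteq> 0 \<and> (\<exists>u. s = u + lm h))"

end

section \<open>Linear independence modulo an ideal\<close>

text \<open>Polynomials as a vector space over their coefficients, scalars acting as constant
  polynomials. This provides the comparison of dimensions in
  \<open>card_le_card_monoms\<close>.\<close>

interpretation coeffs: vector_space "\<lambda>(c::'a::field) f. Poly_Mapping.single (0 :: 'x monom) c * f"
  by standard (simp_all add: algebra_simps single_add mult_single flip: mult.assoc)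

declare coeffs.scale_scale [simp del]

text \<open>The representatives of the \<open>v i\<close> inherit independence, even before passing
  to the quotient by \<open>J\<close>, and lie in a space spanned by \<open>card B\<close>
  monomials.\<close>

lemma card_le_card_monoms:
  fixes v :: "'i \<Rightarrow> ('x, 'a::field) mpoly"
  assumes J: "ideals.subspace J" and fin: "finite A" "finite B"
    and red: "\<And>i. i \<in> A \<Longrightarrow> \<exists>r. Poly_Mapping.keys r \<subseteq> B \<and> v i - r \<in> J"
    and indep: "\<And>c i. (\<Sum>i\<in>A. Poly_Mapping.single 0 (c i) * v i) \<in> J \<Longrightarrow> i \<in> A \<Longrightarrow> c i = 0"
  shows "card A \<le> card B"
proof -
  obtain r where r: "\<And>i. i \<in> A \<Longrightarrow> Poly_Mapping.keys (r i) \<subseteq> B \<and> v i - r i \<in> J"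
    using red by metis
  have zero: "c i = 0" if "(\<Sum>i\<in>A. Poly_Mapping.single 0 (c i) * r i) = 0" "i \<in> A" for c i
  proof (rule indep[OF _ that(2)])
    have "(\<Sum>i\<in>A. Poly_Mapping.single 0 (c i) * (v i - r i)) \<in> J"
      using r J by (intro ideals.subspace_sum ideals.subspace_scale) auto
    then show "(\<Sum>i\<in>A. Poly_Mapping.single 0 (c i) * v i) \<in> J"
      using that(1) by (simp add: right_diff_distrib sum_subtractf)
  qed
  \<comment> \<open>Two equal representatives would satisfy the relation with coefficients 1 and -1.
    Injectivity turns independence of the family into independence of the set \<open>r\<close> takes
    as values.\<close>
  have inj: "inj_on r A"
  proof (rule inj_onI, rule ccontr)
    fix i j assume ij: "i \<in> A" "j \<in> A" "r i = r j" "i \<noteq> j"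
    let ?c = "\<lambda>k. if k = i then 1 else if k = j then - 1 else (0::'a)"
    have "(\<Sum>k\<in>A. Poly_Mapping.single 0 (?c k) * r k) = (\<Sum>k\<in>{i, j}. Poly_Mapping.single 0 (?c k) * r k)"
      using fin(1) ij by (intro sum.mono_neutral_right) auto
    also have "\<dots> = 0"
      using ij by (simp add: single_uminus)
    finally show False
      using zero[of ?c i] ij by simp
  qed
  have "coeffs.independent (r ` A)"
    unfolding coeffs.dependent_finite[OF finite_imageI[OF fin(1)]]
    using zero[of "\<lambda>i. u (r i)" for u] by (auto simp: sum.reindex[OF inj])
  moreover have "r ` A \<subseteq> coeffs.span ((\<lambda>t. Poly_Mapping.single t 1) ` B)"
  proof safe
    fix i assume "i \<in> A"
    then have "r i = (\<Sum>t\<in>B. Poly_Mapping.single 0 (Poly_Mapping.lookup (r i) t) * Poly_Mapping.single t 1)"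
      using poly_mapping_sum_single[of B "r i"] r fin(2) by (simp add: mult_single)
    also have "\<dots> \<in> coeffs.span ((\<lambda>t. Poly_Mapping.single t 1) ` B)"
      by (intro coeffs.span_sum coeffs.span_scale) (auto intro: coeffs.span_base)
    finally show "r i \<in> coeffs.span ((\<lambda>t. Poly_Mapping.single t 1) ` B)" .
  qed
  ultimately have "card (r ` A) \<le> card ((\<lambda>t. Poly_Mapping.single t (1::'a)) ` B)"
    using coeffs.independent_span_bound[OF finite_imageI[OF fin(2)]] by blast
  also have "\<dots> \<le> card B"
    by (rule card_image_le[OF fin(2)])
  finally show ?thesis
    using card_image[OF inj] by simp
qed

text \<open>Linear extension from monomials to polynomials. The factor \<open>q\<close> is 1 for
  division by \<open>H\<close> and a power of \<open>c\<close> for the reduction into a box.\<close>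

lemma reduce_termwise:
  fixes J :: "('x, 'a::field) mpoly set"
  assumes J: "ideals.subspace J"
    and red: "\<And>t. t \<in> Poly_Mapping.keys f \<Longrightarrow> \<exists>r. Poly_Mapping.keys r \<subseteq> B \<and> q * Poly_Mapping.single t 1 - r \<in> J"
  shows "\<exists>r. Poly_Mapping.keys r \<subseteq> B \<and> q * f - r \<in> J"
proof -
  obtain r where r: "\<And>t. t \<in> Poly_Mapping.keys f \<Longrightarrow> Poly_Mapping.keys (r t) \<subseteq> B \<and> q * Poly_Mapping.single t 1 - r t \<in> J"
    using red by metis
  let ?c = "\<lambda>t. Poly_Mapping.single 0 (Poly_Mapping.lookup f t)"
  have "f = (\<Sum>t\<in>Poly_Mapping.keys f. ?c t * Poly_Mapping.single t 1)"
    using poly_mapping_sum_single[of "Poly_Mapping.keys f" f] by (simp add: mult_single)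
  then have "q * f = (\<Sum>t\<in>Poly_Mapping.keys f. ?c t * (q * Poly_Mapping.single t 1))"
    by (metis (no_types, lifting) mult.left_commute sum.cong sum_distrib_left)
  then have "q * f - (\<Sum>t\<in>Poly_Mapping.keys f. ?c t * r t) =
    (\<Sum>t\<in>Poly_Mapping.keys f. ?c t * (q * Poly_Mapping.single t 1 - r t))"
    by (simp add: right_diff_distrib sum_subtractf)
  also have "\<dots> \<in> J"
    using r J by (intro ideals.subspace_sum ideals.subspace_scale) auto
  finally have "q * f - (\<Sum>t\<in>Poly_Mapping.keys f. ?c t * r t) \<in> J" .
  moreover have "Poly_Mapping.keys (\<Sum>t\<in>Poly_Mapping.keys f. ?c t * r t) \<subseteq> B"
    using r keys_sum[of "\<lambda>t. ?c t * r t"] keys_single_times[of 0] by fastforce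
  ultimately show ?thesis
    by blast
qed

section \<open>Remainders supported on standard monomials\<close>

context monomial_ordering
begin

text \<open>By the choice of \<open>w\<close>, replacing a leading monomial by the lower terms
  strictly decreases the weight. Hence induction on the weight bound works, and the remainder obeys
  the same bound as \<open>f\<close>.\<close>

lemma reduce_to_standard:
  fixes J :: "('x, 'a::field) mpoly set"
  assumes J: "ideals.subspace J" "H \<subseteq> J"
    and w: "\<And>h s. h \<in> H \<Longrightarrow> s \<in> Poly_Mapping.keys h \<Longrightarrow> s \<noteq> lm h \<Longrightarrow> weight w s < weight w (lm h)"
    and f: "\<And>t. t \<in> Poly_Mapping.keys f \<Longrightarrow> weight w t < n"
  shows "\<exists>r. Poly_Mapping.keys r \<subseteq> {s. standard H s \<and> weight w s < n} \<and> f - r \<in> J"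
  using f
proof (induction n arbitrary: f)
  case 0
  then have "f = 0"
    by (metis not_less0 keys_eq_empty all_not_in_conv)
  then show ?case
    using ideals.subspace_0[OF J(1)] by (intro exI[of _ 0]) simp
next
  case (Suc n)
  have "\<exists>r. Poly_Mapping.keys r \<subseteq> {s. standard H s \<and> weight w s < Suc n} \<and> 1 * Poly_Mapping.single t 1 - r \<in> J"
    if "t \<in> Poly_Mapping.keys f" for t
  proof (cases "standard H t")
    case True
    then show ?thesis
      using Suc.prems[OF that] ideals.subspace_0[OF J(1)] by (intro exI[of _ "Poly_Mapping.single t 1"]) simp
  next
    case False
    then obtain h u where h: "h \<in> H" "h \<noteq> 0" "t = u + lm h"
      by (auto simp: standard_def)
    let ?q = "Poly_Mapping.single u (1 / lc (\<preceq>) h)"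
    let ?g = "Poly_Mapping.single t 1 - ?q * h"
    have "weight w s < n" if s: "s \<in> Poly_Mapping.keys ?g" for s
    proof -
      have "Poly_Mapping.lookup ?g t = 0"
        using lookup_single_times[of u "1 / lc (\<preceq>) h" h "lm h"] lc_nonzero[OF h(2)]
        by (simp add: h(3) lookup_minus lc_def)
      then have "s \<noteq> t"
        using s by (auto simp: in_keys_iff)
      moreover have "s = t \<or> s \<in> (+) u ` Poly_Mapping.keys h"
        using s keys_diff[of "Poly_Mapping.single t 1" "?q * h"] keys_single_times[of u _ h] by auto
      ultimately obtain s' where "s = u + s'" "s' \<in> Poly_Mapping.keys h" "s' \<noteq> lm h"
        using h(3) by auto
      then have "weight w s < weight w t"
        using w[OF h(1), of s'] h(3) by (simp add: weight_add)
      then show ?thesis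
        using Suc.prems[OF \<open>t \<in> Poly_Mapping.keys f\<close>] by simp
    qed
    then obtain r where r: "Poly_Mapping.keys r \<subseteq> {s. standard H s \<and> weight w s < n}" "?g - r \<in> J"
      using Suc.IH by blast
    have "?g - r + ?q * h \<in> J"
      using r(2) h(1) J ideals.subspace_add ideals.subspace_scale by blast
    then show ?thesis
      using r(1) by (intro exI[of _ r]) (auto simp: algebra_simps)
  qed
  then show ?case
    using reduce_termwise[OF J(1), of f _ 1] by simp
qed

lemma standard_independent:
  assumes J: "lm_generates H J" and f: "f \<in> J" "\<And>t. t \<in> Poly_Mapping.keys f \<Longrightarrow> standard H t"
  shows "f = 0"
  using lm_generatesE[OF J f(1)] f(2) lm_in_keys unfolding standard_def by metis

end

section \<open>Polynomials in a subset of the variables\<close>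

lemma polys_in_single: "Poly_Mapping.keys t \<subseteq> V \<Longrightarrow> Poly_Mapping.single t c \<in> polys_in V"
  by (simp add: polys_in_def)

lemma keys_monom_add: "Poly_Mapping.keys (s + t :: 'x monom) = Poly_Mapping.keys s \<union> Poly_Mapping.keys t"
  by (auto simp: in_keys_iff lookup_add)

lemma polys_in_mult:
  fixes f g :: "('x, 'a::comm_ring_1) mpoly"
  assumes "f \<in> polys_in V" "g \<in> polys_in V"
  shows "f * g \<in> polys_in V"
  using assms keys_mult_subset[of _ f g] by (fastforce simp: polys_in_def keys_monom_add)

lemma polys_in_one: "(1 :: ('x, 'a::comm_ring_1) mpoly) \<in> polys_in V"
  by (simp add: polys_in_def)

lemma polys_in_prod:
  fixes f :: "'i \<Rightarrow> ('x, 'a::comm_ring_1) mpoly"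
  shows "(\<And>i. i \<in> A \<Longrightarrow> f i \<in> polys_in V) \<Longrightarrow> prod f A \<in> polys_in V"
  by (induction A rule: infinite_finite_induct) (simp_all add: polys_in_mult polys_in_one)

lemma polys_in_power:
  fixes f :: "('x, 'a::comm_ring_1) mpoly"
  shows "f \<in> polys_in V \<Longrightarrow> f ^ n \<in> polys_in V"
  by (induction n) (simp_all add: polys_in_mult polys_in_one)

lemma polys_in_sum:
  fixes f :: "'i \<Rightarrow> ('x, 'a::comm_ring_1) mpoly"
  assumes "\<And>i. i \<in> A \<Longrightarrow> f i \<in> polys_in V"
  shows "sum f A \<in> polys_in V"
  using assms keys_sum[of f A] by (fastforce simp: polys_in_def)

context monomial_ordering
begin

text \<open>Read \<open>g\<close> as a polynomial in \<open>x\<close>: \<open>c\<close> collects the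
  coefficients of the highest power of \<open>x\<close>, and \<open>p\<close> is minus the
  rest.\<close>

lemma leading_coefficient_in_variable:
  fixes g :: "('x, 'a::field) mpoly"
  assumes J: "ideals.subspace J" and g: "g \<in> J" "g \<noteq> 0" "g \<in> polys_in (insert x U)"
  obtains c m p where "c \<in> polys_in U" "c \<noteq> 0" "m > 0"
    "c * Poly_Mapping.single (Poly_Mapping.single x m) 1 - p \<in> J"
    "\<And>t. t \<in> Poly_Mapping.keys p \<Longrightarrow> Poly_Mapping.keys t \<subseteq> insert x U \<and> Poly_Mapping.lookup t x < m"
proof -
  define X where "X k = Poly_Mapping.single (Poly_Mapping.single x k) (1::'a)" for k :: nat
  define m where "m = Max ((\<lambda>t. Poly_Mapping.lookup t x) ` Poly_Mapping.keys g)"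
  define T where "T = {t \<in> Poly_Mapping.keys g. Poly_Mapping.lookup t x = m}"
  define c where "c = (\<Sum>t\<in>T. Poly_Mapping.single (t - Poly_Mapping.single x m) (Poly_Mapping.lookup g t))"
  define p where "p = - (\<Sum>t\<in>Poly_Mapping.keys g - T. Poly_Mapping.single t (Poly_Mapping.lookup g t))"
  have le: "Poly_Mapping.lookup t x \<le> m" if "t \<in> Poly_Mapping.keys g" for t
    using that by (simp add: m_def)
  have "m \<in> (\<lambda>t. Poly_Mapping.lookup t x) ` Poly_Mapping.keys g"
    unfolding m_def using g(2) by (intro Max_in) auto
  then obtain t0 where t0: "t0 \<in> T"
    by (auto simp: T_def)
  have shift: "t - Poly_Mapping.single x m + Poly_Mapping.single x m = t" if "t \<in> T" for t
    using that by (intro poly_mapping_eqI) (auto simp: T_def lookup_add lookup_minus lookup_single when_def)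
  have "g = (\<Sum>t\<in>T. Poly_Mapping.single t (Poly_Mapping.lookup g t)) - p"
    using poly_mapping_sum_single[of "Poly_Mapping.keys g" g]
      sum.subset_diff[of T "Poly_Mapping.keys g" "\<lambda>t. Poly_Mapping.single t (Poly_Mapping.lookup g t)"]
    by (simp add: p_def T_def add.commute)
  also have "(\<Sum>t\<in>T. Poly_Mapping.single t (Poly_Mapping.lookup g t)) = c * X m"
    by (simp add: c_def X_def sum_distrib_right mult_single shift cong: sum.cong)
  finally have gc: "g = c * X m - p" .
  have pkeys: "t \<in> Poly_Mapping.keys g \<and> Poly_Mapping.lookup t x < m" if "t \<in> Poly_Mapping.keys p" for t
  proof -
    have "t \<in> Poly_Mapping.keys g - T"
      using that keys_sum[of "\<lambda>t. Poly_Mapping.single t (Poly_Mapping.lookup g t)" "Poly_Mapping.keys g - T"]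
      by (fastforce simp: p_def split: if_splits)
    then show ?thesis
      using le[of t] by (auto simp: T_def)
  qed
  have "c \<in> polys_in U"
    unfolding c_def
  proof (intro polys_in_sum polys_in_single)
    fix t assume t: "t \<in> T"
    then have "Poly_Mapping.keys t \<subseteq> insert x U"
      using g(3) by (auto simp: polys_in_def T_def)
    moreover have "Poly_Mapping.lookup (t - Poly_Mapping.single x m) y =
        (if y = x then 0 else Poly_Mapping.lookup t y)" for y
      using t by (simp add: lookup_minus lookup_single when_def T_def)
    ultimately show "Poly_Mapping.keys (t - Poly_Mapping.single x m) \<subseteq> U"
      by (auto simp: in_keys_iff subset_iff)
  qed
  moreover have "c \<noteq> 0"
  proof
    assume "c = 0"
    then have "g = - p"
      using gc by simp
    then show False
      using pkeys[of t0] t0 by (simp add: T_def)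
  qed
  \<comment> \<open>One extra factor \<open>x\<close> makes the exponent positive even when
    \<open>g\<close> does not involve \<open>x\<close>.\<close>
  moreover have "c * X (Suc m) - p * X 1 \<in> J"
  proof -
    have "X 1 * g \<in> J"
      using J g(1) by (rule ideals.subspace_scale)
    also have "X 1 * g = c * (X m * X 1) - p * X 1"
      unfolding gc by (simp add: algebra_simps)
    also have "X m * X 1 = X (Suc m)"
      by (simp add: X_def mult_single single_add[symmetric])
    finally show ?thesis .
  qed
  moreover have "Poly_Mapping.keys t \<subseteq> insert x U \<and> Poly_Mapping.lookup t x < Suc m"
    if t: "t \<in> Poly_Mapping.keys (p * X 1)" for t
  proof -
    obtain a b where ab: "t = a + b" "a \<in> Poly_Mapping.keys p" "b \<in> Poly_Mapping.keys (X 1)"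
      using keys_mult_subset[OF t] by blast
    then have "b = Poly_Mapping.single x 1"
      by (simp add: X_def)
    then show ?thesis
      using ab pkeys[of a] g(3) by (auto simp: keys_monom_add lookup_add polys_in_def split: if_splits)
  qed
  ultimately show ?thesis
    using that[of c "Suc m" "p * X 1"] by (simp add: X_def)
qed

text \<open>Each relation is multiplied by the leading coefficients of all the others, so that a
  single denominator \<open>c\<close> serves every variable outside \<open>U\<close>.\<close>

lemma common_leading_coefficient:
  fixes J :: "('x, 'a::field) mpoly set"
  assumes J: "ideals.subspace J" and alg: "\<And>x. x \<notin> U \<Longrightarrow> \<exists>g\<in>J. g \<noteq> 0 \<and> g \<in> polys_in (insert x U)"
  obtains c m p where "c \<in> polys_in U" "c \<noteq> 0" "\<And>x. m x > 0"
    "\<And>x. x \<notin> U \<Longrightarrow> c * Poly_Mapping.single (Poly_Mapping.single x (m x)) 1 - p x \<in> J"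
    "\<And>x t. x \<notin> U \<Longrightarrow> t \<in> Poly_Mapping.keys (p x) \<Longrightarrow>
      Poly_Mapping.keys t \<subseteq> insert x U \<and> Poly_Mapping.lookup t x < m x"
proof -
  have "\<exists>c m p. x \<notin> U \<longrightarrow> c \<in> polys_in U \<and> c \<noteq> 0 \<and> m > 0 \<and>
    c * Poly_Mapping.single (Poly_Mapping.single x m) 1 - p \<in> J \<and>
    (\<forall>t\<in>Poly_Mapping.keys p. Poly_Mapping.keys t \<subseteq> insert x U \<and> Poly_Mapping.lookup t x < m)" for x
  proof (cases "x \<in> U")
    case False
    then obtain g where "g \<in> J" "g \<noteq> 0" "g \<in> polys_in (insert x U)"
      using alg by blast
    then obtain c m p where "c \<in> polys_in U" "c \<noteq> 0" "m > 0"
      "c * Poly_Mapping.single (Poly_Mapping.single x m) 1 - p \<in> J"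
      "\<And>t. t \<in> Poly_Mapping.keys p \<Longrightarrow> Poly_Mapping.keys t \<subseteq> insert x U \<and> Poly_Mapping.lookup t x < m"
      using leading_coefficient_in_variable[OF J] by blast
    then show ?thesis
      by blast
  qed simp
  then obtain c m p where cmp: "\<And>x. x \<notin> U \<Longrightarrow> c x \<in> polys_in U \<and> c x \<noteq> 0 \<and> m x > 0 \<and>
    c x * Poly_Mapping.single (Poly_Mapping.single x (m x)) 1 - p x \<in> J \<and>
    (\<forall>t\<in>Poly_Mapping.keys (p x). Poly_Mapping.keys t \<subseteq> insert x U \<and> Poly_Mapping.lookup t x < m x)"
    by metis
  define q where "q x = (\<Prod>y\<in>- U - {x}. c y)" for x
  have q: "q x \<in> polys_in U" for x
    unfolding q_def using cmp by (intro polys_in_prod) simp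
  define cc where "cc = prod c (- U)"
  have cc: "cc = c x * q x" if "x \<notin> U" for x
    unfolding cc_def q_def using that by (intro prod.remove) auto
  have 1: "cc \<in> polys_in U"
    unfolding cc_def using cmp by (intro polys_in_prod) simp
  have 2: "cc \<noteq> 0"
    unfolding cc_def using cmp by (intro prod_nonzero) simp
  have 3: "cc * Poly_Mapping.single (Poly_Mapping.single x (m x)) 1 - q x * p x \<in> J" if "x \<notin> U" for x
  proof -
    have "q x * (c x * Poly_Mapping.single (Poly_Mapping.single x (m x)) 1 - p x) \<in> J"
      using cmp[OF that] J ideals.subspace_scale by blast
    then show ?thesis
      by (simp add: cc[OF that] right_diff_distrib mult.assoc mult.left_commute)
  qed
  have 4: "Poly_Mapping.keys t \<subseteq> insert x U \<and> Poly_Mapping.lookup t x < m x"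
    if x: "x \<notin> U" and t: "t \<in> Poly_Mapping.keys (q x * p x)" for x t
  proof -
    obtain a b where ab: "t = a + b" "a \<in> Poly_Mapping.keys (q x)" "b \<in> Poly_Mapping.keys (p x)"
      using keys_mult_subset[OF t] by blast
    have "Poly_Mapping.keys a \<subseteq> U"
      using q[of x] ab(2) by (auto simp: polys_in_def)
    moreover from this have "Poly_Mapping.lookup a x = 0"
      using x by (metis in_keys_iff subsetD)
    ultimately show ?thesis
      using ab cmp[OF x] by (auto simp: keys_monom_add lookup_add)
  qed
  \<comment> \<open>The value 1 on \<open>U\<close> is a default that makes \<open>m\<close>
    positive everywhere.\<close>
  show ?thesis
    by (rule that[of cc "\<lambda>x. if x \<in> U then 1 else m x" "\<lambda>x. q x * p x"]) (use 1 2 3 4 cmp in auto)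
qed

end

section \<open>Rewriting monomials into boxes, up to a denominator\<close>

definition degree_in :: "'x::finite set \<Rightarrow> 'x monom \<Rightarrow> nat"
  where "degree_in V = weight (\<lambda>x. if x \<in> V then 1 else 0)"

lemma degree_in_add: "degree_in V (s + t) = degree_in V s + degree_in V t"
  by (simp add: degree_in_def weight_add)

lemma degree_in_eq_0: "Poly_Mapping.keys t \<inter> V = {} \<Longrightarrow> degree_in V t = 0"
  by (auto simp: degree_in_def weight_def in_keys_iff disjoint_iff)

lemma degree_in_only:
  assumes "Poly_Mapping.keys t \<inter> V \<subseteq> {x}"
  shows "degree_in V t \<le> Poly_Mapping.lookup t x"
proof -
  have "degree_in V t = (\<Sum>y\<in>{x}. (if y \<in> V then 1 else 0) * Poly_Mapping.lookup t y)"
    unfolding degree_in_def weight_def using assms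
    by (intro sum.mono_neutral_right) (auto simp: in_keys_iff)
  then show ?thesis
    by simp
qed

lemma lookup_le_degree_in: "x \<in> V \<Longrightarrow> Poly_Mapping.lookup t x \<le> degree_in V t"
  unfolding degree_in_def weight_def
  using member_le_sum[of x UNIV "\<lambda>x. (if x \<in> V then 1 else 0) * Poly_Mapping.lookup t x"] by simp

lemma degree_in_le_weight:
  assumes "\<And>x. w x > 0"
  shows "degree_in V t \<le> weight w t"
  unfolding degree_in_def weight_def using assms by (intro sum_mono) (simp add: Suc_leI)

text \<open>Finitely many exponent patterns outside \<open>U\<close>, and degree at most
  \<open>e\<close> in \<open>U\<close>: the size grows only like \<open>e ^ card U\<close>.\<close>

definition box :: "'x::finite set \<Rightarrow> ('x \<Rightarrow> nat) \<Rightarrow> nat \<Rightarrow> 'x monom set"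
  where "box U m e = {s. (\<forall>x. x \<notin> U \<longrightarrow> Poly_Mapping.lookup s x < m x) \<and> degree_in U s \<le> e}"

lemma card_bounded_monoms:
  "card {t :: 'x::finite monom. \<forall>x. Poly_Mapping.lookup t x \<le> b x} = (\<Prod>x\<in>UNIV. b x + 1)"
proof -
  let ?S = "{t :: 'x monom. \<forall>x. Poly_Mapping.lookup t x \<le> b x}"
  have "Poly_Mapping.lookup ` ?S = Pi\<^sub>E UNIV (\<lambda>x. {..b x})"
  proof (intro equalityI subsetI)
    fix f assume f: "f \<in> Pi\<^sub>E UNIV (\<lambda>x. {..b x})"
    have "Poly_Mapping.lookup (Abs_poly_mapping f) = f"
      by (simp add: Abs_poly_mapping_inverse)
    then show "f \<in> Poly_Mapping.lookup ` ?S"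
      using f by (intro image_eqI[of _ _ "Abs_poly_mapping f"]) (auto simp: PiE_def Pi_def)
  qed (auto simp: PiE_def Pi_def)
  then have "card (Pi\<^sub>E UNIV (\<lambda>x. {..b x})) = card ?S"
    using card_image[of Poly_Mapping.lookup ?S] by (simp add: inj_on_def)
  then show ?thesis
    by (simp add: card_PiE)
qed

lemma card_monoms_in:
  "card {t :: 'x::finite monom. \<forall>x. Poly_Mapping.lookup t x \<le> (if x \<in> U then k else 0)} = (k + 1) ^ card U"
proof -
  have "(\<Prod>x\<in>UNIV. (if x \<in> U then k else 0) + 1) = (\<Prod>x\<in>UNIV. if x \<in> U then k + 1 else 1)"
    by (intro prod.cong) auto
  then show ?thesis
    unfolding card_bounded_monoms by (simp add: prod.If_cases)
qed

lemma
  fixes U :: "'x::finite set"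
  shows finite_box: "finite (box U m e)"
    and card_box: "card (box U m e) \<le> (\<Prod>x\<in>- U. m x + 1) * (e + 1) ^ card U"
proof -
  let ?b = "\<lambda>x. if x \<in> U then e else m x"
  have sub: "box U m e \<subseteq> {t. \<forall>x. Poly_Mapping.lookup t x \<le> ?b x}"
    using lookup_le_degree_in[of _ U] by (auto simp: box_def intro: less_imp_le le_trans)
  then show "finite (box U m e)"
    by (rule finite_subset[OF _ finite_bounded_monoms])
  have "card (box U m e) \<le> (\<Prod>x\<in>UNIV. ?b x + 1)"
    using card_mono[OF finite_bounded_monoms sub] unfolding card_bounded_monoms .
  also have "\<dots> = (\<Prod>x\<in>UNIV. if x \<in> U then e + 1 else m x + 1)"
    by (intro prod.cong) auto
  also have "\<dots> = (\<Prod>x\<in>- U. m x + 1) * (e + 1) ^ card U"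
    by (simp add: prod.If_cases Compl_eq)
  finally show "card (box U m e) \<le> (\<Prod>x\<in>- U. m x + 1) * (e + 1) ^ card U" .
qed

lemma keys_power_degree_in:
  fixes c :: "('x::finite, 'a::comm_ring_1) mpoly"
  assumes "\<And>t. t \<in> Poly_Mapping.keys c \<Longrightarrow> degree_in V t \<le> E"
  shows "t \<in> Poly_Mapping.keys (c ^ n) \<Longrightarrow> degree_in V t \<le> E * n"
proof (induction n arbitrary: t)
  case 0
  then show ?case
    by (simp add: degree_in_eq_0)
next
  case (Suc n)
  then obtain a b where "t = a + b" "a \<in> Poly_Mapping.keys c" "b \<in> Poly_Mapping.keys (c ^ n)"
    using keys_mult_subset[of t c "c ^ n"] by auto
  then show ?case
    using assms[of a] Suc.IH[of b] by (simp add: degree_in_add)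
qed

lemma keys_times_box:
  fixes f :: "('x::finite, 'a::comm_ring_1) mpoly"
  assumes c: "c \<in> polys_in U" "\<And>t. t \<in> Poly_Mapping.keys c \<Longrightarrow> degree_in U t \<le> d"
    and f: "Poly_Mapping.keys f \<subseteq> box U m e"
  shows "Poly_Mapping.keys (c * f) \<subseteq> box U m (e + d)"
proof
  fix t assume "t \<in> Poly_Mapping.keys (c * f)"
  then obtain a b where ab: "t = a + b" "a \<in> Poly_Mapping.keys c" "b \<in> box U m e"
    using keys_mult_subset[of t c f] f by blast
  have "Poly_Mapping.keys a \<subseteq> U"
    using c(1) ab(2) by (auto simp: polys_in_def)
  then have "Poly_Mapping.lookup a x = 0" if "x \<notin> U" for x
    using that by (metis in_keys_iff subsetD)
  then show "t \<in> box U m (e + d)"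
    using ab c(2)[of a] by (auto simp: box_def lookup_add degree_in_add)
qed

text \<open>Rewriting a power of \<open>x\<close> outside \<open>U\<close> uses one factor
  \<open>c\<close>, lowers the degree outside \<open>U\<close> by at least 1, and raises the degree
  in \<open>U\<close> by at most \<open>E\<close>. So \<open>n\<close> factors suffice.\<close>

lemma reduce_to_box:
  fixes J :: "('x::finite, 'a::field) mpoly set"
  assumes J: "ideals.subspace J" and c: "c \<in> polys_in U" and m: "\<And>x. m x > 0"
    and rel: "\<And>x. x \<notin> U \<Longrightarrow> c * Poly_Mapping.single (Poly_Mapping.single x (m x)) 1 - p x \<in> J"
    and keys_p: "\<And>x t. x \<notin> U \<Longrightarrow> t \<in> Poly_Mapping.keys (p x) \<Longrightarrow>
      Poly_Mapping.keys t \<subseteq> insert x U \<and> Poly_Mapping.lookup t x < m x"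
    and E: "\<And>t. t \<in> Poly_Mapping.keys c \<Longrightarrow> degree_in U t \<le> E"
      "\<And>x t. x \<notin> U \<Longrightarrow> t \<in> Poly_Mapping.keys (p x) \<Longrightarrow> degree_in U t \<le> E"
    and "degree_in (- U) t \<le> n"
  shows "\<exists>r. Poly_Mapping.keys r \<subseteq> box U m (degree_in U t + E * n) \<and> c ^ n * Poly_Mapping.single t 1 - r \<in> J"
  using \<open>degree_in (- U) t \<le> n\<close>
proof (induction n arbitrary: t rule: less_induct)
  case (less n)
  show ?case
  proof (cases "\<forall>x. x \<notin> U \<longrightarrow> Poly_Mapping.lookup t x < m x")
    \<comment> \<open>The monomial is in the box already; the remaining power of \<open>c\<close> is
      kept, at the cost of at most \<open>E * n\<close> in the degree.\<close>
    case True
    then have "Poly_Mapping.keys (Poly_Mapping.single t (1::'a)) \<subseteq> box U m (degree_in U t)"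
      by (simp add: box_def)
    then have "Poly_Mapping.keys (c ^ n * Poly_Mapping.single t 1) \<subseteq> box U m (degree_in U t + E * n)"
      by (intro keys_times_box[OF polys_in_power[OF c]] keys_power_degree_in[where c = c] E(1))
    then show ?thesis
      using ideals.subspace_0[OF J] by (intro exI[of _ "c ^ n * Poly_Mapping.single t 1"]) simp
  next
    case False
    then obtain x where x: "x \<notin> U" "m x \<le> Poly_Mapping.lookup t x"
      by (auto simp: not_less)
    define t' where "t' = t - Poly_Mapping.single x (m x)"
    have t: "t = Poly_Mapping.single x (m x) + t'"
      unfolding t'_def using x(2)
      by (intro poly_mapping_eqI) (auto simp: lookup_add lookup_minus lookup_single when_def)
    have "degree_in (- U) t \<ge> 1"
      using lookup_le_degree_in[of x "- U" t] x m[of x] by simp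
    then obtain n' where n: "n = Suc n'"
      using less.prems by (cases n) auto
    have single_x: "degree_in (- U) (Poly_Mapping.single x (m x)) \<ge> m x"
      using lookup_le_degree_in[of x "- U" "Poly_Mapping.single x (m x)"] x by simp
    have "\<exists>r. Poly_Mapping.keys r \<subseteq> box U m (degree_in U t + E * n) \<and> c ^ n' * Poly_Mapping.single \<tau> 1 - r \<in> J"
      if \<tau>: "\<tau> \<in> Poly_Mapping.keys (p x * Poly_Mapping.single t' 1)" for \<tau>
    proof -
      obtain a where a: "\<tau> = a + t'" "a \<in> Poly_Mapping.keys (p x)"
        using keys_mult_subset[OF \<tau>] by auto
      \<comment> \<open>Outside \<open>U\<close>, only \<open>x\<close> can occur in
        \<open>p x\<close>, with exponent below \<open>m x\<close>; this makes the degree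
        drop.\<close>
      have "degree_in (- U) a < m x"
        using degree_in_only[of a "- U" x] keys_p[OF x(1) a(2)] by force
      then have V: "degree_in (- U) \<tau> \<le> n'"
        using less.prems single_x unfolding t a(1) degree_in_add n by linarith
      have "degree_in U \<tau> \<le> degree_in U t + E"
        using E(2)[OF x(1) a(2)] unfolding t a(1) degree_in_add by linarith
      then have "box U m (degree_in U \<tau> + E * n') \<subseteq> box U m (degree_in U t + E * n)"
        unfolding n box_def by auto
      then show ?thesis
        using less.IH[of n' \<tau>] V n by blast
    qed
    then obtain r where r: "Poly_Mapping.keys r \<subseteq> box U m (degree_in U t + E * n)"
      "c ^ n' * (p x * Poly_Mapping.single t' 1) - r \<in> J"
      using reduce_termwise[OF J] by metis
    have "c ^ n * Poly_Mapping.single t 1 - r =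
      (c ^ n' * Poly_Mapping.single t' 1) * (c * Poly_Mapping.single (Poly_Mapping.single x (m x)) 1 - p x) +
      (c ^ n' * (p x * Poly_Mapping.single t' 1) - r)"
    proof -
      have "Poly_Mapping.single t 1 = Poly_Mapping.single (Poly_Mapping.single x (m x)) 1 * Poly_Mapping.single t' (1::'a)"
        by (simp add: t mult_single)
      then show ?thesis
        unfolding n by (simp add: algebra_simps)
    qed
    also have "\<dots> \<in> J"
      using r(2) rel[OF x(1)] J ideals.subspace_add ideals.subspace_scale by blast
    finally show ?thesis
      using r(1) by blast
  qed
qed

section \<open>Associated primes with a common maximal independent set\<close>

lemma subspace_colon:
  assumes "ideals.subspace I"
  shows "ideals.subspace {f. f * b \<in> I}"
  unfolding ideals.subspace_def
  using assms by (auto simp: distrib_right mult.assoc ideals.subspace_0 ideals.subspace_add ideals.subspace_scale)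

lemma colon_singleton: "colon I {f} = {a. a * f \<in> I}"
  by (simp add: colon_def)

lemma Ass_MIS_D:
  assumes "P \<in> Ass_MIS U I"
  shows "primeideal P mpoly_ring" "\<exists>f. P = colon I {f}" "polys_in U \<inter> P = {0}"
    "\<And>x. x \<notin> U \<Longrightarrow> \<exists>g\<in>P. g \<noteq> 0 \<and> g \<in> polys_in (insert x U)"
proof -
  show "primeideal P mpoly_ring" "\<exists>f. P = colon I {f}" "polys_in U \<inter> P = {0}"
    using assms by (auto simp: Ass_MIS_def Ass_def is_MIS_def independent_mod_def)
  fix x assume "x \<notin> U"
  then have "polys_in (insert x U) \<inter> P \<noteq> {0}"
    using assms by (auto simp: Ass_MIS_def is_MIS_def independent_mod_def)
  moreover have "0 \<in> polys_in (insert x U) \<inter> P"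
    using \<open>primeideal P mpoly_ring\<close> by (auto simp: polys_in_def primeideal_iff ideals.subspace_0)
  ultimately show "\<exists>g\<in>P. g \<noteq> 0 \<and> g \<in> polys_in (insert x U)"
    by blast
qed

context monomial_ordering
begin

text \<open>
  Write each prime as \<open>(I : f P)\<close>. Finitely many of the \<open>f P\<close> generate, together with \<open>I\<close>, the
  same ideal as all of them, so already the intersection of the corresponding finitely many primes
  is contained in all of them.
\<close>

lemma Inter_Ass_MIS_dependent:
  fixes I :: "('x, 'a::field) mpoly set"
  assumes I: "ideals.subspace I" and x: "x \<notin> U"
  shows "\<exists>g\<in>\<Inter> (Ass_MIS U I). g \<noteq> 0 \<and> g \<in> polys_in (insert x U)"
proof -
  let ?A = "Ass_MIS U I"
  obtain f where f: "\<And>P. P \<in> ?A \<Longrightarrow> P = {a. a * f P \<in> I}"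
    using Ass_MIS_D(2) unfolding colon_singleton by metis
  obtain B where B: "finite B" "B \<subseteq> f ` ?A \<union> I" "f ` ?A \<union> I \<subseteq> ideals.span B"
    using noetherian .
  obtain A0 where A0: "finite A0" "A0 \<subseteq> ?A" "B - I = f ` A0"
  proof -
    have "finite (B - I)" "B - I \<subseteq> f ` ?A"
      using B by auto
    then show ?thesis
      using finite_subset_image[of "B - I" f ?A] that by metis
  qed
  obtain g where g: "\<And>P. P \<in> ?A \<Longrightarrow> g P \<in> P \<and> g P \<noteq> 0 \<and> g P \<in> polys_in (insert x U)"
  proof -
    have "\<forall>P\<in>?A. \<exists>g. g \<in> P \<and> g \<noteq> 0 \<and> g \<in> polys_in (insert x U)"
      using Ass_MIS_D(4)[OF _ x] by blast
    then show ?thesis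
      using that by (metis (no_types))
  qed
  let ?h = "prod g A0"
  have "?h \<in> Q" if Q: "Q \<in> ?A" for Q
  proof -
    \<comment> \<open>A generator outside \<open>I\<close> is some \<open>f P\<close>, which the
      factor \<open>g P\<close> of \<open>?h\<close> multiplies into \<open>I\<close>. Hence
      \<open>?h\<close> does the same for the whole span of \<open>B\<close>, in particular for
      \<open>f Q\<close>.\<close>
    have "?h * b \<in> I" if b: "b \<in> B" for b
    proof (cases "b \<in> I")
      case False
      then obtain P where P: "P \<in> A0" "b = f P"
        using A0(3) b by blast
      then have "g P * b \<in> I"
        using f[of P] g[of P] A0(2) by auto
      moreover have "?h * b = prod g (A0 - {P}) * (g P * b)"
        using prod.remove[OF A0(1) P(1), of g] by (simp add: mult_ac)
      ultimately show ?thesis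
        using I ideals.subspace_scale by metis
    qed (use I ideals.subspace_scale in blast)
    then have "ideals.span B \<subseteq> {b. b * ?h \<in> I}"
      using ideals.span_minimal[OF _ subspace_colon[OF I, of ?h], of B] by (auto simp only: mult.commute)
    then have "?h * f Q \<in> I"
      using B(3) Q by (auto simp: mult.commute)
    then show ?thesis
      using f[OF Q] by blast
  qed
  moreover have "?h \<noteq> 0"
    using g A0(2) by (intro prod_nonzero) auto
  moreover have "?h \<in> polys_in (insert x U)"
    using g A0(2) by (intro polys_in_prod) auto
  ultimately show ?thesis
    by blast
qed

text \<open>Multiplication by \<open>c ^ D\<close> moves standard monomials of weight below
  \<open>D\<close> into a box, modulo the intersection. It preserves independence, because the
  nonzero \<open>c\<close> in the variables \<open>U\<close> lies in none of the primes.\<close>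

lemma card_standard_le:
  fixes I :: "('x, 'a::field) mpoly set" and w :: "'x \<Rightarrow> nat"
  assumes I: "ideals.subspace I" and H: "lm_generates H (\<Inter> (Ass_MIS U I))" and w: "\<And>x. w x > 0"
  shows "\<exists>M E. \<forall>D. card {s. standard H s \<and> weight w s < D} \<le> M * (E * D + 1) ^ card U"
proof -
  let ?J = "\<Inter> (Ass_MIS U I)"
  have prime: "primeideal P mpoly_ring" if "P \<in> Ass_MIS U I" for P
    using Ass_MIS_D(1)[OF that] .
  then have J: "ideals.subspace ?J"
    by (intro ideals.subspace_Inter) (auto simp: primeideal_iff)
  obtain c m p where c: "c \<in> polys_in U" "c \<noteq> 0" "\<And>x. m x > 0"
    "\<And>x. x \<notin> U \<Longrightarrow> c * Poly_Mapping.single (Poly_Mapping.single x (m x)) 1 - p x \<in> ?J"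
    "\<And>x t. x \<notin> U \<Longrightarrow> t \<in> Poly_Mapping.keys (p x) \<Longrightarrow>
      Poly_Mapping.keys t \<subseteq> insert x U \<and> Poly_Mapping.lookup t x < m x"
    using common_leading_coefficient[OF J Inter_Ass_MIS_dependent[OF I]] by metis
  \<comment> \<open>\<open>Max S\<close> bounds the degree in \<open>U\<close> of \<open>c\<close>
    and of all \<open>p x\<close>.\<close>
  define S where "S = degree_in U ` (Poly_Mapping.keys c \<union> (\<Union>x. Poly_Mapping.keys (p x)))"
  have "finite S"
    by (simp add: S_def)
  then have E: "\<And>t. t \<in> Poly_Mapping.keys c \<Longrightarrow> degree_in U t \<le> Max S"
    "\<And>x t. x \<notin> U \<Longrightarrow> t \<in> Poly_Mapping.keys (p x) \<Longrightarrow> degree_in U t \<le> Max S"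
    unfolding S_def by (blast intro: Max_ge)+
  have "card {s. standard H s \<and> weight w s < D} \<le> (\<Prod>x\<in>- U. m x + 1) * ((Max S + 1) * D + 1) ^ card U" for D
  proof -
    let ?A = "{s. standard H s \<and> weight w s < D}"
    have fin: "finite ?A"
      by (rule finite_subset[OF _ finite_weight_le[of w D, OF w]]) auto
    \<comment> \<open>The summand \<open>D\<close> bounds the degree of the monomial itself, and
      \<open>Max S * D\<close> the increase caused by the \<open>D\<close> factors
      \<open>c\<close>.\<close>
    have "card ?A \<le> card (box U m (D + Max S * D))"
    proof (rule card_le_card_monoms[OF J fin finite_box])
      fix s assume s: "s \<in> ?A"
      then have deg: "degree_in U s \<le> D" "degree_in (- U) s \<le> D"
        using degree_in_le_weight[of w U s, OF w] degree_in_le_weight[of w "- U" s, OF w] by auto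
      have "box U m (degree_in U s + Max S * D) \<subseteq> box U m (D + Max S * D)"
        using deg(1) by (auto simp: box_def)
      moreover have "\<exists>r. Poly_Mapping.keys r \<subseteq> box U m (degree_in U s + Max S * D) \<and>
          c ^ D * Poly_Mapping.single s 1 - r \<in> ?J"
        by (rule reduce_to_box[where p = p]) (use J c E deg(2) in blast)+
      ultimately show "\<exists>r. Poly_Mapping.keys r \<subseteq> box U m (D + Max S * D) \<and>
          c ^ D * Poly_Mapping.single s 1 - r \<in> ?J"
        by blast
    next
      fix a s assume a: "(\<Sum>s\<in>?A. Poly_Mapping.single 0 (a s) * (c ^ D * Poly_Mapping.single s 1)) \<in> ?J"
        and s: "s \<in> ?A"
      let ?f = "\<Sum>s\<in>?A. Poly_Mapping.single s (a s)"
      have "(\<Sum>s\<in>?A. Poly_Mapping.single 0 (a s) * (c ^ D * Poly_Mapping.single s 1)) = c ^ D * ?f"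
        by (simp add: sum_distrib_left mult.left_commute[of _ "c ^ D"] mult_single)
      then have cf: "c ^ D * ?f \<in> ?J"
        using a by simp
      have "?f \<in> P" if P: "P \<in> Ass_MIS U I" for P
      proof -
        have "c \<notin> P"
          using Ass_MIS_D(3)[OF P] c(1,2) by blast
        then have "c ^ D \<notin> P"
          using prime_ideal_power[OF prime[OF P]] by blast
        then show ?thesis
          using cf P prime[OF P] by (auto simp: primeideal_iff)
      qed
      moreover have lookup_f: "Poly_Mapping.lookup ?f t = (if t \<in> ?A then a t else 0)" for t
        using fin by (simp add: lookup_sum lookup_single when_def)
      then have "standard H t" if "t \<in> Poly_Mapping.keys ?f" for t
        using that by (auto simp: in_keys_iff split: if_splits)
      ultimately have "?f = 0"
        using standard_independent[OF H] by blast
      then show "a s = 0"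
        using lookup_f[of s] s by simp
    qed
    also have "\<dots> \<le> (\<Prod>x\<in>- U. m x + 1) * ((Max S + 1) * D + 1) ^ card U"
      using card_box[of U m "D + Max S * D"] by (simp add: algebra_simps)
    finally show ?thesis .
  qed
  then show ?thesis
    by blast
qed

end

section \<open>Algebraic dependence modulo a prime ideal\<close>

text \<open>As \<open>J\<close> is prime and \<open>a\<close> is outside it, factors
  \<open>a\<close> can be cancelled from the relation until its constant coefficient is nonzero;
  this coefficient is \<open>h\<close>.\<close>

lemma nonzero_constant_term_mod:
  assumes J: "primeideal J mpoly_ring" and a: "a \<notin> J"
    and "(\<Sum>i<n. q i * a ^ i) \<in> J" "\<And>i. q i \<in> polys_in U" "i < n" "q i \<noteq> 0"
  shows "\<exists>h b. h \<in> polys_in U \<and> h \<noteq> 0 \<and> h - a * b \<in> J"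
  using assms(3-)
proof (induction n arbitrary: q i)
  case (Suc n)
  let ?s = "\<Sum>i<n. q (Suc i) * a ^ i"
  have eq: "(\<Sum>i<Suc n. q i * a ^ i) = q 0 - a * (- ?s)"
    by (subst sum.lessThan_Suc_shift) (simp add: sum_distrib_left mult.left_commute)
  show ?case
  proof (cases "q 0 = 0")
    case False
    then show ?thesis
      using Suc.prems(1,2) unfolding eq by blast
  next
    case True
    then have "a * ?s \<in> J"
      using Suc.prems(1) unfolding eq by simp
    then have "?s \<in> J"
      using J a by (auto simp: primeideal_iff)
    moreover obtain j where "i = Suc j"
      using Suc.prems(4) True by (cases i) auto
    ultimately show ?thesis
      using Suc.IH[of "\<lambda>i. q (Suc i)" j] Suc.prems by auto
  qed
qed simp

lemma keys_power_weight:
  fixes a :: "('x::finite, 'a::comm_ring_1) mpoly"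
  assumes "\<And>t. t \<in> Poly_Mapping.keys a \<Longrightarrow> weight w t \<le> E"
  shows "t \<in> Poly_Mapping.keys (a ^ n) \<Longrightarrow> weight w t \<le> E * n"
proof (induction n arbitrary: t)
  case 0
  then show ?case
    by (simp add: weight_def)
next
  case (Suc n)
  then obtain a' b where "t = a' + b" "a' \<in> Poly_Mapping.keys a" "b \<in> Poly_Mapping.keys (a ^ n)"
    using keys_mult_subset[of t a "a ^ n"] by auto
  then show ?case
    using assms[of a'] Suc.IH[of b] by (simp add: weight_add)
qed

context monomial_ordering
begin

text \<open>
  Otherwise the products of \<open>a ^ i\<close>, \<open>i \<le> k\<close>, with the monomials in \<open>U\<close> of exponents at most \<open>k\<close>
  are linearly independent modulo \<open>J\<close>. There are \<open>(k + 1) ^ (card U + 1)\<close> of them, too many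
  for the standard monomials of weight linear in \<open>k\<close>.
\<close>

lemma multiple_in_polys_in_mod_prime:
  fixes J :: "('x, 'a::field) mpoly set" and w :: "'x \<Rightarrow> nat"
  assumes J: "primeideal J mpoly_ring" and a: "a \<notin> J" and H: "H \<subseteq> J"
    and w: "\<And>x. w x > 0"
      "\<And>h s. h \<in> H \<Longrightarrow> s \<in> Poly_Mapping.keys h \<Longrightarrow> s \<noteq> lm h \<Longrightarrow> weight w s < weight w (lm h)"
    and bound: "\<And>D. card {s. standard H s \<and> weight w s < D} \<le> M * (E * D + 1) ^ card U"
  obtains h b where "h \<in> polys_in U" "h \<noteq> 0" "h - a * b \<in> J"
proof -
  have Jsub: "ideals.subspace J"
    using J by (simp add: primeideal_iff)
  define W where "W = (\<Sum>x\<in>UNIV. w x)"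
  define d where "d = (\<Sum>t\<in>Poly_Mapping.keys a. weight w t)"
  have d: "weight w t \<le> d" if "t \<in> Poly_Mapping.keys a" for t
    unfolding d_def using that by (intro member_le_sum) auto
  \<comment> \<open>\<open>K\<close> is independent of \<open>k\<close> and is chosen to give
    \<open>E * D + 1 \<le> K * (k + 1)\<close>.\<close>
  define K where "K = E * (W + d) + E + 1"
  \<comment> \<open>Now the bound on standard monomials is at most
    \<open>M * (K * (k + 1)) ^ card U = k * (k + 1) ^ card U\<close>, less than the number
    \<open>(k + 1) ^ (card U + 1)\<close> of products.\<close>
  define k where "k = M * K ^ card U"
  \<comment> \<open>The products have weight at most \<open>(W + d) * k\<close>; the summand 1 makes
    the bound strict.\<close>
  define D where "D = (W + d) * k + 1"
  define T where "T = {t :: 'x monom. \<forall>x. Poly_Mapping.lookup t x \<le> (if x \<in> U then k else 0)}"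
  define v where "v = (\<lambda>(t, i). Poly_Mapping.single t 1 * a ^ i)"
  have finT: "finite T"
    unfolding T_def by (rule finite_bounded_monoms)
  have small: "weight w s < D" if i: "i \<in> T \<times> {..<Suc k}" and s: "s \<in> Poly_Mapping.keys (v i)" for i s
  proof -
    obtain t j where tj: "i = (t, j)" "t \<in> T" "j \<le> k"
      using i by auto
    obtain b where b: "s = t + b" "b \<in> Poly_Mapping.keys (a ^ j)"
      using keys_single_times[of t 1 "a ^ j"] s by (auto simp: v_def tj(1))
    have "weight w t \<le> (\<Sum>x\<in>UNIV. w x * k)"
      unfolding weight_def
    proof (intro sum_mono mult_left_mono)
      fix x
      show "Poly_Mapping.lookup t x \<le> k"
        using tj(2) by (cases "x \<in> U") (auto simp: T_def dest: spec[of _ x])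
    qed simp
    also have "\<dots> = W * k"
      by (simp add: W_def sum_distrib_right)
    finally have "weight w t \<le> W * k" .
    moreover have "weight w b \<le> d * j"
      using keys_power_weight[of a w d, OF d b(2)] .
    then have "weight w b \<le> d * k"
      using tj(3) mult_le_mono2 order_trans by blast
    ultimately show ?thesis
      by (simp add: D_def b(1) weight_add algebra_simps)
  qed
  let ?S = "{s. standard H s \<and> weight w s < D}"
  have finS: "finite ?S"
    by (rule finite_subset[OF _ finite_weight_le[of w D, OF w(1)]]) auto
  have "\<not> (\<forall>c i. (\<Sum>i\<in>T \<times> {..<Suc k}. Poly_Mapping.single 0 (c i) * v i) \<in> J \<longrightarrow>
    i \<in> T \<times> {..<Suc k} \<longrightarrow> c i = 0)"
  proof
    assume indep: "\<forall>c i. (\<Sum>i\<in>T \<times> {..<Suc k}. Poly_Mapping.single 0 (c i) * v i) \<in> J \<longrightarrow>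
      i \<in> T \<times> {..<Suc k} \<longrightarrow> c i = 0"
    have "card (T \<times> {..<Suc k}) \<le> card ?S"
    proof (rule card_le_card_monoms[OF Jsub _ finS, of "T \<times> {..<Suc k}" v])
      fix i assume "i \<in> T \<times> {..<Suc k}"
      then show "\<exists>r. Poly_Mapping.keys r \<subseteq> ?S \<and> v i - r \<in> J"
        using small by (intro reduce_to_standard[OF Jsub H w(2)]) blast+
    qed (use finT indep in blast)+
    also have "\<dots> \<le> M * (E * D + 1) ^ card U"
      by (rule bound)
    also have "\<dots> \<le> M * (K * (k + 1)) ^ card U"
    proof -
      have "E * D + 1 \<le> K * (k + 1)"
        by (simp add: K_def D_def algebra_simps)
      then show ?thesis
        by (intro mult_left_mono power_mono) auto
    qed
    also have "\<dots> = k * (k + 1) ^ card U"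
      by (simp only: k_def power_mult_distrib mult.assoc)
    also have "card (T \<times> {..<Suc k}) = (k + 1) ^ card U * (k + 1)"
      by (simp add: card_cartesian_product T_def card_monoms_in)
    finally show False
      by simp
  qed
  then obtain c t i where c: "(\<Sum>i\<in>T \<times> {..<Suc k}. Poly_Mapping.single 0 (c i) * v i) \<in> J"
    and ti: "t \<in> T" "i < Suc k" "c (t, i) \<noteq> 0"
    by auto
  define q where "q i = (\<Sum>t\<in>T. Poly_Mapping.single t (c (t, i)))" for i
  \<comment> \<open>The dependence is sorted by powers of \<open>a\<close>, with coefficients
    \<open>q i\<close> in the variables \<open>U\<close>.\<close>
  have "(\<Sum>i\<in>T \<times> {..<Suc k}. Poly_Mapping.single 0 (c i) * v i) =
      (\<Sum>i<Suc k. \<Sum>t\<in>T. Poly_Mapping.single 0 (c (t, i)) * v (t, i))"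
    by (subst sum.swap) (simp only: sum.cartesian_product split_def prod.collapse)
  also have "\<dots> = (\<Sum>i<Suc k. q i * a ^ i)"
    by (simp add: v_def q_def sum_distrib_right mult_single flip: mult.assoc)
  finally have "(\<Sum>i<Suc k. q i * a ^ i) \<in> J"
    using c by simp
  moreover have "q i \<in> polys_in U" for i
    unfolding q_def
  proof (intro polys_in_sum polys_in_single)
    fix t assume t: "t \<in> T"
    have "Poly_Mapping.lookup t x = 0" if "x \<notin> U" for x
      using t that by (auto simp: T_def dest: spec[of _ x])
    then show "Poly_Mapping.keys t \<subseteq> U"
      by (auto simp: in_keys_iff)
  qed
  moreover have "Poly_Mapping.lookup (q i) t = c (t, i)"
    using finT ti(1) by (simp add: q_def lookup_sum lookup_single when_def)
  then have "q i \<noteq> 0"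
    using ti(3) by auto
  ultimately show ?thesis
    using nonzero_constant_term_mod[OF J a, of q "Suc k" U i] ti(2) that by blast
qed

text \<open>Reduction preserves the leading monomials of \<open>H\<close>. This carries the count of
  standard monomials from \<open>Hbar\<close> back to \<open>Hcan\<close>.\<close>

lemma standard_phi:
  assumes "permissible TYPE('p::prime_card) (\<preceq>) H"
  shows "standard (phi ` H :: ('x, 'p mod_ring) mpoly set) s \<longleftrightarrow> standard H s"
  using lm_phi[OF assms] by (auto simp: standard_def)

end

section \<open>The prime \<open>J\<close> as the colon ideal of \<open>I\<close> by a single element
  of \<open>L\<close>\<close>

theorem corollary2p3p2:
  fixes mo :: "'x::finite monom \<Rightarrow> 'x monom \<Rightarrow> bool"
    and F I Hcan J L :: "('x, rat) mpoly set"
    and U :: "'x set"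
    and Hbar Jbar :: "('x, 'p::prime_card mod_ring) mpoly set"
  assumes "monomial_order mo"
    and "ideal I mpoly_ring"
    and "groebner_basis mo F I"
    and "permissible TYPE('p) mo F"
    and "Ass_MIS U (I_p F :: ('x, 'p mod_ring) mpoly set) \<noteq> {}"
    and "Jbar = \<Inter> (Ass_MIS U (I_p F))"
    and "groebner_basis mo Hbar Jbar"
    and "finite Hcan"
    and "phi ` Hcan = Hbar"
    and "J = ideal_gen Hcan"
    and "permissible TYPE('p) mo Hcan"
    and "groebner_basis mo Hcan J"
    and "reduced_groebner_basis mo L (colon I J)"
    and "effectively_lucky TYPE('p) mo L"
    and "(I_p L :: ('x, 'p mod_ring) mpoly set) = colon (I_p F) (I_p Hcan)"
    and "primeideal J mpoly_ring"
  shows "J \<in> Ass I"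
proof -
  interpret monomial_ordering mo
    by unfold_locales (rule assms(1))
  let ?Ib = "I_p F :: ('x, 'p mod_ring) mpoly set"
  have I: "ideals.subspace I"
    using assms(2) by (simp add: ideal_iff_subspace)
  have Ib: "ideals.subspace ?Ib"
    by (simp add: I_p_def genideal_eq_span)
  have IJ: "ideals.subspace (colon I J)"
  proof -
    have "colon I J = (\<Inter>b\<in>J. {f. f * b \<in> I})"
      by (auto simp: colon_def)
    then show ?thesis
      using subspace_colon[OF I] by (auto intro: ideals.subspace_Int)
  qed
  have L_gen: "lm_generates L (colon I J)"
    using assms(13) unfolding reduced_groebner_basis_def by (blast intro: groebner_basis_lm_generates)
  have L_sub: "L \<subseteq> colon I J" and L_fin: "finite L"
    using assms(13) by (auto simp: reduced_groebner_basis_def groebner_basis_def)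
  \<comment> \<open>Effective luckiness provides some permissible reduced Groebner basis of the
    ideal of \<open>L\<close>; by uniqueness it is \<open>L\<close>, which is therefore integral at
    \<open>p\<close>.\<close>
  have L_Z: "L \<subseteq> Z_loc_polys CARD('p)"
  proof -
    obtain G where G: "reduced_groebner_basis mo G (ideal_gen L)" "permissible TYPE('p) mo G"
      using assms(14) by (auto simp: effectively_lucky_def)
    then have "G = L"
      using reduced_groebner_basis_unique[OF _ assms(13) IJ] lm_generates_span[OF L_gen IJ]
      by (simp add: genideal_eq_span)
    then show ?thesis
      using G(2) by (simp add: permissible_def)
  qed
  obtain P where P: "P \<in> Ass_MIS U ?Ib"
    using assms(5) by blast
  then obtain f where f: "P = {a. a * f \<in> ?Ib}"
    using Ass_MIS_D(2) unfolding colon_singleton by metis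
  \<comment> \<open>\<open>Hbar\<close> lies in \<open>P\<close>, so \<open>f\<close> multiplies its
    span into \<open>I_p F\<close>; the assumed formula for \<open>I_p L\<close> then
    applies.\<close>
  have f_in: "f \<in> I_p L"
  proof -
    have "ideals.span Hbar \<subseteq> P"
      using assms(6,7) P Ass_MIS_D(1)[OF P]
      by (intro ideals.span_minimal) (auto simp: groebner_basis_def primeideal_iff)
    then show ?thesis
      using f unfolding assms(15) colon_def
      by (auto simp: I_p_def assms(9) genideal_eq_span mult.commute)
  qed
  have not_all: "\<not> (\<forall>l\<in>L. h * l \<in> I)" if h: "h \<in> polys_in U" "h \<noteq> 0" for h
  proof
    assume hL: "\<forall>l\<in>L. h * l \<in> I"
    obtain c where c: "Poly_Mapping.single 0 c * h \<in> Z_loc_polys CARD('p)"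
      "phi (Poly_Mapping.single 0 c * h) \<noteq> (0 :: ('x, 'p mod_ring) mpoly)"
      using exists_primitive_multiple[OF h(2), where ?'p = 'p] by metis
    define h' where "h' = Poly_Mapping.single 0 c * h"
    define hb where "hb = (phi h' :: ('x, 'p mod_ring) mpoly)"
    have "hb * l \<in> ?Ib" if l: "l \<in> phi ` L" for l
    proof -
      obtain l' where l': "l' \<in> L" "l = phi l'"
        using l by blast
      have "h' * l' \<in> I"
        using hL l'(1) I ideals.subspace_scale unfolding h'_def mult.assoc by blast
      then have "phi (h' * l') \<in> ?Ib"
        using phi_in_I_p[OF assms(3,4) I] Z_loc_polys_mult[where ?'p = 'p] c(1) L_Z l'(1)
        unfolding h'_def by blast
      then show ?thesis
        using phi_mult[where ?'p = 'p, of h' l'] c(1) L_Z l' by (auto simp: hb_def h'_def)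
    qed
    then have "ideals.span (phi ` L) \<subseteq> {l. l * hb \<in> ?Ib}"
      by (intro ideals.span_minimal subspace_colon Ib) (auto simp: mult.commute)
    then have "hb \<in> P"
      using f_in f by (auto simp: I_p_def genideal_eq_span mult.commute)
    moreover have "h' \<in> polys_in U"
      unfolding h'_def using h(1) by (intro polys_in_mult polys_in_single) simp_all
    then have "hb \<in> polys_in U"
      using keys_phi[where ?'p = 'p, of h'] by (auto simp: polys_in_def hb_def)
    ultimately show False
      using Ass_MIS_D(3)[OF P] c(2) by (auto simp: hb_def h'_def)
  qed
  \<comment> \<open>If each \<open>l\<close> had its own multiplier \<open>h l\<close>, their
    product would multiply all of \<open>L\<close> into \<open>I\<close>, contradicting
    \<open>not_all\<close>.\<close>
  obtain g where g: "g \<in> L" "\<And>h. h \<in> polys_in U \<Longrightarrow> h \<noteq> 0 \<Longrightarrow> h * g \<notin> I"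
  proof (rule ccontr)
    assume "\<not> thesis"
    then have "\<forall>l\<in>L. \<exists>h. h \<in> polys_in U \<and> h \<noteq> 0 \<and> h * l \<in> I"
      using that by blast
    then obtain h where h: "\<And>l. l \<in> L \<Longrightarrow> h l \<in> polys_in U \<and> h l \<noteq> 0 \<and> h l * l \<in> I"
      by metis
    have "prod h L * l \<in> I" if "l \<in> L" for l
    proof -
      have "prod h L * l = prod h (L - {l}) * (h l * l)"
        using prod.remove[OF L_fin that, of h] by (simp add: mult_ac)
      then show ?thesis
        using h[OF that] I ideals.subspace_scale by metis
    qed
    then show False
      using not_all[of "prod h L"] polys_in_prod[of L h U] prod_nonzero[of L h] h by blast
  qed
  have "J = {a. a * g \<in> I}"
  proof
    show "J \<subseteq> {a. a * g \<in> I}"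
      using g(1) L_sub by (auto simp: colon_def mult.commute)
    show "{a. a * g \<in> I} \<subseteq> J"
    proof (rule ccontr)
      assume "\<not> {a. a * g \<in> I} \<subseteq> J"
      then obtain a where a: "a * g \<in> I" "a \<notin> J"
        by blast
      have Hcan: "Hcan \<subseteq> J"
        unfolding assms(10) genideal_eq_span by (rule ideals.span_superset)
      \<comment> \<open>The weights are adapted to \<open>Hcan\<close>, where division takes place.
        The count for \<open>Hbar\<close> holds for any positive weights, so the same ones serve
        both sides.\<close>
      obtain w :: "'x \<Rightarrow> nat" where w: "\<And>x. w x > 0"
        "\<And>h s. h \<in> Hcan \<Longrightarrow> s \<in> Poly_Mapping.keys h \<Longrightarrow> s \<noteq> lm h \<Longrightarrow> weight w s < weight w (lm h)"
        using exists_weights[OF assms(8)] by metis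
      have "lm_generates Hbar (\<Inter> (Ass_MIS U ?Ib))"
        using groebner_basis_lm_generates[OF assms(7)] assms(6) by simp
      then obtain M E where "\<forall>D. card {s. standard Hbar s \<and> weight w s < D} \<le> M * (E * D + 1) ^ card U"
        using card_standard_le[of ?Ib Hbar U w, OF Ib _ w(1)] by blast
      then have bound: "card {s. standard Hcan s \<and> weight w s < D} \<le> M * (E * D + 1) ^ card U" for D
        by (simp add: standard_phi[OF assms(11)] flip: assms(9))
      obtain h b where h: "h \<in> polys_in U" "h \<noteq> 0" "h - a * b \<in> J"
        by (rule multiple_in_polys_in_mod_prime[OF assms(16) a(2) Hcan w bound])
      have "(h - a * b) * g \<in> I"
        using h(3) g(1) L_sub by (auto simp: colon_def mult.commute)
      moreover have "b * (a * g) \<in> I"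
        using a(1) I ideals.subspace_scale by blast
      ultimately have "(h - a * b) * g + b * (a * g) \<in> I"
        using I ideals.subspace_add by blast
      then have "h * g \<in> I"
        by (simp add: algebra_simps)
      then show False
        using g(2) h by blast
    qed
  qed
  then show ?thesis
    using assms(16) unfolding Ass_def colon_singleton by blast
qed

end
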